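(* Let $M$ be a von Neumann algebra, $D\subseteq B\subseteq M$ von Neumann subalgebras, and $E_D:M\to D$ a faithful normal conditional expectation. Let $X_1,\dots,X_n\in M$ be self-adjoint; for each $j$ let $B_j$ be the von Neumann algebra generated by $B$ and all $X_k$ with $k\ne j$, and assume that each conjugate variable $J_D(X_j:B_j)$ exists. Put $$\Phi_D^{**}(X_1,\dots,X_n:B):=\sum_{j=1}^nE_D\big(J_D(X_j:B_j)^*J_D(X_j:B_j)\big)\in D_+ .$$ Then, in the positive cone order of $D$, $$\Phi_D^{**}(X_1,\dots,X_n:B)\ \sum_{j=1}^n\|E_D(X_j^2)\|\ \ge\ n^2\,1_D ,$$ where $\|\cdot\|$ is the $C^*$-norm on $D$ (so the sum is a scalar).
   Context: $D$-valued inner product on $M$: $\langle x,y\rangle_D:=E_D(x^*y)$; $L^2_D(M)$ is the right Hilbert $C^*$-module over $D$ obtained by completing $M$ in $\|x\|_{2,D}:=\|E_D(x^*x)\|^{1/2}$. For $\xi,\eta\in L^2_D(M)$ write $E_D(\xi^*\eta):=\langle\xi,\eta\rangle_D$. For $X=X^*\in M$ and a von Neumann algebra $C$ with $D\subseteq C\subseteq M$: $C\langle X\rangle\subseteq M$ is the unital $*$-algebra generated by $C$ and $X$, with closure $L^2_D(C\langle X\rangle)$ in $L^2_D(M)$. Whenever conjugate variables are considered, $X$ is assumed algebraically free from $C$ modulo $D$ (the canonical homomorphism into $M$ from the algebra of formal noncommutative polynomials in a self-adjoint indeterminate with coefficients in $C$, sending the indeterminate to $X$, is injective), so that the free difference quotient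 $\partial_{X:C}:C\langle X\rangle\to C\langle X\rangle\otimes_DC\langle X\rangle$ is the well-defined $D$-bimodular derivation with $\partial_{X:C}(c)=0$ for $c\in C$ and $\partial_{X:C}(c_0Xc_1\cdots Xc_m)=\sum_{j=1}^m(c_0X\cdots Xc_{j-1})\otimes(c_jX\cdots Xc_m)$. On $C\langle X\rangle\otimes_DC\langle X\rangle$ use $\langle p_1\otimes q_1,p_2\otimes q_2\rangle_D:=E_D(q_1^*E_D(p_1^*p_2)q_2)$. The conjugate variable $J_D(X:C)=\partial_{X:C}^*(1\otimes1)$ exists if there is $J\in L^2_D(C\langle X\rangle)$ with $\langle J,p\rangle_D=\langle1\otimes1,\partial_{X:C}(p)\rangle_D$ for all $p\in C\langle X\rangle$; then $J_D(X:C):=J$. *)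

theory Defs
  imports "HOL-Analysis.Analysis" "HOL-Library.Poly_Mapping"
    "HOL-Computational_Algebra.Group_Closure"
begin

section \<open>Complex Hilbert spaces and their operators\<close>

text \<open>The inner product is conjugate-linear in the first and linear in the second argument.\<close>

class complex_hilbert_space = banach +
  fixes scaleC :: "complex \<Rightarrow> 'a \<Rightarrow> 'a"
    and cinner :: "'a \<Rightarrow> 'a \<Rightarrow> complex"
  assumes scaleC_add_right: "scaleC c (x + y) = scaleC c x + scaleC c y"
    and scaleC_add_left: "scaleC (b + c) x = scaleC b x + scaleC c x"
    and scaleC_scaleC: "scaleC b (scaleC c x) = scaleC (b * c) x"
    and scaleC_of_real: "scaleC (complex_of_real r) x = r *\<^sub>R x"
    and cinner_commute: "cinner x y = cnj (cinner y x)"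
    and cinner_add_right: "cinner x (y + z) = cinner x y + cinner x z"
    and cinner_scaleC_right: "cinner x (scaleC c y) = c * cinner x y"
    and norm_eq_sqrt_cinner: "norm x = sqrt (Re (cinner x x))"

instantiation complex :: complex_hilbert_space
begin
definition scaleC_complex :: "complex \<Rightarrow> complex \<Rightarrow> complex" where
  "scaleC_complex c x = c * x"
definition cinner_complex :: "complex \<Rightarrow> complex \<Rightarrow> complex" where
  "cinner_complex x y = cnj x * y"
instance
  by standard
    (auto simp: scaleC_complex_def cinner_complex_def algebra_simps scaleR_conv_of_real
      cmod_def power2_eq_square)
end

lemma norm_scaleC: "norm (scaleC c (x :: 'h :: complex_hilbert_space)) = cmod c * norm x"
proof -
  have im: "Im (cinner x x) = 0"
    using arg_cong[OF cinner_commute[of x x], of Im] by simp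
  have "cinner (scaleC c x) (scaleC c x) = c * cnj c * cinner x x"
    by (metis cinner_commute cinner_scaleC_right complex_cnj_mult mult.assoc)
  then have "Re (cinner (scaleC c x) (scaleC c x)) = (cmod c)\<^sup>2 * Re (cinner x x)"
    using im by (simp flip: complex_norm_square of_real_power)
  then show ?thesis
    by (simp add: norm_eq_sqrt_cinner[where 'a = 'h] real_sqrt_mult)
qed

type_synonym 'h op = "'h \<Rightarrow>\<^sub>L 'h"

text \<open>
  \<^typ>\<open>'h op\<close> contains all bounded real-linear maps;
  \<open>B(H)\<close> is its subset \<open>{A. clinear_op A}\<close>.
\<close>

definition clinear_op :: "'h::complex_hilbert_space op \<Rightarrow> bool" where
  "clinear_op A \<longleftrightarrow> (\<forall>c x. A (scaleC c x) = scaleC c (A x))"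

lift_definition scaleC_op :: "complex \<Rightarrow> 'h::complex_hilbert_space op \<Rightarrow> 'h op"
  is "\<lambda>c A x. scaleC c (A x)"
proof -
  fix c :: complex and A :: "'h \<Rightarrow> 'h"
  assume "bounded_linear A"
  moreover have "bounded_linear (scaleC c :: 'h \<Rightarrow> 'h)"
  proof (rule bounded_linear_intro)
    show "scaleC c (r *\<^sub>R x) = r *\<^sub>R scaleC c x" for r and x :: 'h
      by (metis mult.commute scaleC_of_real scaleC_scaleC)
    show "norm (scaleC c x) \<le> norm x * cmod c" for x :: 'h
      by (simp add: norm_scaleC)
  qed (simp add: scaleC_add_right)
  ultimately show "bounded_linear (\<lambda>x. scaleC c (A x))"
    by (rule bounded_linear_compose[rotated])
qed

definition is_adjoint :: "'h::complex_hilbert_space op \<Rightarrow> 'h op \<Rightarrow> bool" where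
  "is_adjoint A B \<longleftrightarrow> (\<forall>x y. cinner (A x) y = cinner x (B y))"

definition star :: "'h::complex_hilbert_space op \<Rightarrow> 'h op" where
  "star A = (THE B. is_adjoint A B)"

definition positive_op :: "'h::complex_hilbert_space op \<Rightarrow> bool" where
  "positive_op A \<longleftrightarrow>
     clinear_op A \<and> (\<forall>x. cinner x (A x) \<in> \<real> \<and> 0 \<le> Re (cinner x (A x)))"

section \<open>Von Neumann algebras and conditional expectations\<close>

definition unital_star_algebra :: "'h::complex_hilbert_space op set \<Rightarrow> bool" where
  "unital_star_algebra A \<longleftrightarrow>
     (\<forall>a\<in>A. clinear_op a) \<and> id_blinfun \<in> A \<and>
     (\<forall>a\<in>A. \<forall>b\<in>A. a + b \<in> A) \<and> (\<forall>c. \<forall>a\<in>A. scaleC_op c a \<in> A) \<and>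
     (\<forall>a\<in>A. \<forall>b\<in>A. a o\<^sub>L b \<in> A) \<and> (\<forall>a\<in>A. \<exists>b\<in>A. is_adjoint a b)"

definition wot_closed :: "'h::complex_hilbert_space op set \<Rightarrow> bool" where
  "wot_closed M \<longleftrightarrow>
     (\<forall>a. clinear_op a \<and>
        (\<forall>F e. finite F \<and> 0 < e \<longrightarrow>
           (\<exists>b\<in>M. \<forall>(x, y)\<in>F. cmod (cinner x ((a - b) y)) < e)) \<longrightarrow> a \<in> M)"

definition von_neumann_algebra :: "'h::complex_hilbert_space op set \<Rightarrow> bool" where
  "von_neumann_algebra M \<longleftrightarrow> unital_star_algebra M \<and> wot_closed M"

definition vN_generated :: "'h::complex_hilbert_space op set \<Rightarrow> 'h op set" where
  "vN_generated S = \<Inter>{N. von_neumann_algebra N \<and> S \<subseteq> N}"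

definition pos_cone :: "'h::complex_hilbert_space op set \<Rightarrow> 'h op set" where
  "pos_cone N = {a \<in> N. positive_op a}"

definition vN_le :: "'h::complex_hilbert_space op set \<Rightarrow> 'h op \<Rightarrow> 'h op \<Rightarrow> bool" where
  "vN_le N a b \<longleftrightarrow> a \<in> N \<and> b \<in> N \<and> b - a \<in> pos_cone N"

definition is_sup_in ::
  "'h::complex_hilbert_space op set \<Rightarrow> 'h op set \<Rightarrow> 'h op \<Rightarrow> bool" where
  "is_sup_in N S a \<longleftrightarrow>
     (\<forall>s\<in>S. vN_le N s a) \<and> (\<forall>b. (\<forall>s\<in>S. vN_le N s b) \<longrightarrow> vN_le N a b)"

definition conditional_expectation ::
  "'h::complex_hilbert_space op set \<Rightarrow> 'h op set \<Rightarrow> ('h op \<Rightarrow> 'h op) \<Rightarrow> bool" where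
  "conditional_expectation M D E \<longleftrightarrow>
     (\<forall>x\<in>M. E x \<in> D) \<and> (\<forall>x\<in>M. \<forall>y\<in>M. E (x + y) = E x + E y) \<and>
     (\<forall>c. \<forall>x\<in>M. E (scaleC_op c x) = scaleC_op c (E x)) \<and>
     (\<forall>x\<in>pos_cone M. E x \<in> pos_cone D) \<and> (\<forall>d\<in>D. E d = d) \<and>
     (\<forall>d\<in>D. \<forall>x\<in>M. \<forall>d'\<in>D. E (d o\<^sub>L x o\<^sub>L d') = d o\<^sub>L E x o\<^sub>L d')"

definition faithful_map ::
  "'h::complex_hilbert_space op set \<Rightarrow> ('h op \<Rightarrow> 'h op) \<Rightarrow> bool" where
  "faithful_map M E \<longleftrightarrow> (\<forall>x\<in>M. E (star x o\<^sub>L x) = 0 \<longrightarrow> x = 0)"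

text \<open>
  Normality as preservation of suprema of bounded upward directed families of self-adjoint
  elements; boundedness is implied by the existence of the supremum.
\<close>

definition normal_map ::
  "'h::complex_hilbert_space op set \<Rightarrow> 'h op set \<Rightarrow> ('h op \<Rightarrow> 'h op) \<Rightarrow> bool" where
  "normal_map M D E \<longleftrightarrow>
     (\<forall>S x. S \<noteq> {} \<and> S \<subseteq> {a \<in> M. star a = a} \<and>
        (\<forall>a\<in>S. \<forall>b\<in>S. \<exists>c\<in>S. vN_le M a c \<and> vN_le M b c) \<and> is_sup_in M S x \<longrightarrow>
        is_sup_in D (E ` S) (E x))"

section \<open>The Hilbert module completion\<close>

text \<open>
  \<open>L\<^sup>2\<^sub>D(M)\<close> is the set of classes of \<open>\<parallel>\<cdot>\<parallel>\<^sub>2\<^sub>,\<^sub>D\<close>-Cauchy sequences in \<open>M\<close> modulo null sequences.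
  \<open>L2_inner\<close> and \<open>L2_dist\<close> are the continuous extensions of the inner product and of the
  metric; their values do not depend on the chosen representatives.
\<close>

definition norm2 :: "('h::complex_hilbert_space op \<Rightarrow> 'h op) \<Rightarrow> 'h op \<Rightarrow> real" where
  "norm2 E x = sqrt (norm (E (star x o\<^sub>L x)))"

definition L2_Cauchy ::
  "'h::complex_hilbert_space op set \<Rightarrow> ('h op \<Rightarrow> 'h op) \<Rightarrow> (nat \<Rightarrow> 'h op) set" where
  "L2_Cauchy M E = {x. (\<forall>k. x k \<in> M) \<and>
     (\<forall>e>0. \<exists>K. \<forall>k\<ge>K. \<forall>l\<ge>K. norm2 E (x k - x l) < e)}"

definition L2_rel :: "'h::complex_hilbert_space op set \<Rightarrow> ('h op \<Rightarrow> 'h op) \<Rightarrow>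
    ((nat \<Rightarrow> 'h op) \<times> (nat \<Rightarrow> 'h op)) set" where
  "L2_rel M E = {(x, y). x \<in> L2_Cauchy M E \<and> y \<in> L2_Cauchy M E \<and>
     (\<lambda>k. norm2 E (x k - y k)) \<longlonglongrightarrow> 0}"

definition L2_space ::
  "'h::complex_hilbert_space op set \<Rightarrow> ('h op \<Rightarrow> 'h op) \<Rightarrow> (nat \<Rightarrow> 'h op) set set" where
  "L2_space M E = L2_Cauchy M E // L2_rel M E"

definition L2_embed :: "'h::complex_hilbert_space op set \<Rightarrow> ('h op \<Rightarrow> 'h op) \<Rightarrow>
    'h op \<Rightarrow> (nat \<Rightarrow> 'h op) set" where
  "L2_embed M E x = L2_rel M E `` {\<lambda>_. x}"

definition L2_inner :: "('h::complex_hilbert_space op \<Rightarrow> 'h op) \<Rightarrow>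
    (nat \<Rightarrow> 'h op) set \<Rightarrow> (nat \<Rightarrow> 'h op) set \<Rightarrow> 'h op" where
  "L2_inner E \<xi> \<eta> =
     (let x = (SOME x. x \<in> \<xi>); y = (SOME y. y \<in> \<eta>) in lim (\<lambda>k. E (star (x k) o\<^sub>L y k)))"

definition L2_dist :: "('h::complex_hilbert_space op \<Rightarrow> 'h op) \<Rightarrow>
    (nat \<Rightarrow> 'h op) set \<Rightarrow> (nat \<Rightarrow> 'h op) set \<Rightarrow> real" where
  "L2_dist E \<xi> \<eta> =
     (let x = (SOME x. x \<in> \<xi>); y = (SOME y. y \<in> \<eta>) in lim (\<lambda>k. norm2 E (x k - y k)))"

definition L2_closure :: "'h::complex_hilbert_space op set \<Rightarrow> ('h op \<Rightarrow> 'h op) \<Rightarrow>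
    'h op set \<Rightarrow> (nat \<Rightarrow> 'h op) set set" where
  "L2_closure M E A =
     {\<xi> \<in> L2_space M E. \<forall>e>0. \<exists>p\<in>A. L2_dist E \<xi> (L2_embed M E p) < e}"

section \<open>Noncommutative polynomials\<close>

definition adjoin :: "'h::complex_hilbert_space op set \<Rightarrow> 'h op \<Rightarrow> 'h op set" where
  "adjoin C X = \<Inter>{A. unital_star_algebra A \<and> insert X C \<subseteq> A}"

text \<open>
  A nonempty list \<open>[c\<^sub>0, \<dots>, c\<^sub>m]\<close> over \<open>C\<close> stands for the formal monomial \<open>c\<^sub>0 t c\<^sub>1 \<cdots> t c\<^sub>m\<close>.
  The algebra of formal noncommutative polynomials in \<open>t\<close> with coefficients in \<open>C\<close> is
  \<open>\<Oplus>\<^sub>m C\<^sup>\<otimes>\<^sup>(\<^sup>m\<^sup>+\<^sup>1\<^sup>)\<close> with tensor products over the complex numbers: the free abelian group on such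
  lists modulo additivity in every slot and passing scalars between adjacent slots.
\<close>

definition nc_polys :: "'h::complex_hilbert_space op set \<Rightarrow> ('h op list \<Rightarrow>\<^sub>0 int) set" where
  "nc_polys C = {f. Poly_Mapping.keys f \<subseteq> lists C - {[]}}"

definition nc_relations :: "'h::complex_hilbert_space op set \<Rightarrow> ('h op list \<Rightarrow>\<^sub>0 int) set" where
  "nc_relations C =
     {frag_of (u @ [a + b] @ v) - frag_of (u @ [a] @ v) - frag_of (u @ [b] @ v) | u v a b.
        u \<in> lists C \<and> v \<in> lists C \<and> a \<in> C \<and> b \<in> C} \<union>
     {frag_of (u @ [scaleC_op z a, b] @ v) - frag_of (u @ [a, scaleC_op z b] @ v) | u v a b z.
        u \<in> lists C \<and> v \<in> lists C \<and> a \<in> C \<and> b \<in> C}"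

fun monomial_value :: "'h::complex_hilbert_space op \<Rightarrow> 'h op list \<Rightarrow> 'h op" where
  "monomial_value X [] = id_blinfun"
| "monomial_value X [c] = c"
| "monomial_value X (c # d # w) = c o\<^sub>L X o\<^sub>L monomial_value X (d # w)"

definition nc_eval :: "'h::complex_hilbert_space op \<Rightarrow> ('h op list \<Rightarrow>\<^sub>0 int) \<Rightarrow> 'h op" where
  "nc_eval X f = (\<Sum>w\<in>Poly_Mapping.keys f.
     real_of_int (Poly_Mapping.lookup f w) *\<^sub>R monomial_value X w)"

text \<open>
  Injectivity of the canonical homomorphism. Amalgamating over a subalgebra \<open>D\<close> of \<open>C\<close> gives
  the same algebra of formal polynomials, since the free product over \<open>D\<close> of \<open>C\<close> and
  \<open>D\<langle>t\<rangle>\<close> is \<open>C\<langle>t\<rangle>\<close>; hence \<open>D\<close> is not a parameter.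
\<close>

definition algebraically_free ::
  "'h::complex_hilbert_space op set \<Rightarrow> 'h op \<Rightarrow> bool" where
  "algebraically_free C X \<longleftrightarrow>
     (\<forall>f\<in>nc_polys C. \<forall>g\<in>nc_polys C.
        nc_eval X f = nc_eval X g \<longrightarrow> f - g \<in> group_closure (nc_relations C))"

section \<open>The balanced tensor product and the free difference quotient\<close>

text \<open>
  \<open>A \<otimes>\<^sub>D A\<close> is the free abelian group on \<open>A \<times> A\<close> modulo biadditivity and \<open>D\<close>-balancedness;
  complex homogeneity is included because scalars lie in \<open>D\<close>.
\<close>

definition formal_tensors ::
  "'h::complex_hilbert_space op set \<Rightarrow> ('h op \<times> 'h op \<Rightarrow>\<^sub>0 int) set" where
  "formal_tensors A = {f. Poly_Mapping.keys f \<subseteq> A \<times> A}"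

definition tensor_relations :: "'h::complex_hilbert_space op set \<Rightarrow> 'h op set \<Rightarrow>
    ('h op \<times> 'h op \<Rightarrow>\<^sub>0 int) set" where
  "tensor_relations D A =
     {frag_of (p + p', q) - frag_of (p, q) - frag_of (p', q) | p p' q.
        p \<in> A \<and> p' \<in> A \<and> q \<in> A} \<union>
     {frag_of (p, q + q') - frag_of (p, q) - frag_of (p, q') | p q q'.
        p \<in> A \<and> q \<in> A \<and> q' \<in> A} \<union>
     {frag_of (p o\<^sub>L d, q) - frag_of (p, d o\<^sub>L q) | p q d. p \<in> A \<and> q \<in> A \<and> d \<in> D}"

definition tensor_rel :: "'h::complex_hilbert_space op set \<Rightarrow> 'h op set \<Rightarrow>
    (('h op \<times> 'h op \<Rightarrow>\<^sub>0 int) \<times> ('h op \<times> 'h op \<Rightarrow>\<^sub>0 int)) set" where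
  "tensor_rel D A = {(f, g). f \<in> formal_tensors A \<and> g \<in> formal_tensors A \<and>
     f - g \<in> group_closure (tensor_relations D A)}"

definition tensor_class :: "'h::complex_hilbert_space op set \<Rightarrow> 'h op set \<Rightarrow>
    ('h op \<times> 'h op \<Rightarrow>\<^sub>0 int) \<Rightarrow> ('h op \<times> 'h op \<Rightarrow>\<^sub>0 int) set" where
  "tensor_class D A f = tensor_rel D A `` {f}"

text \<open>
  The additive extension of
  \<open>\<langle>p\<^sub>1 \<otimes> q\<^sub>1, p\<^sub>2 \<otimes> q\<^sub>2\<rangle>\<^sub>D = E\<^sub>D(q\<^sub>1\<^sup>* E\<^sub>D(p\<^sub>1\<^sup>* p\<^sub>2) q\<^sub>2)\<close>, computed on representatives.
\<close>

definition tensor_inner :: "('h::complex_hilbert_space op \<Rightarrow> 'h op) \<Rightarrow>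
    ('h op \<times> 'h op \<Rightarrow>\<^sub>0 int) set \<Rightarrow> ('h op \<times> 'h op \<Rightarrow>\<^sub>0 int) set \<Rightarrow> 'h op" where
  "tensor_inner E S T =
     (let f = (SOME f. f \<in> S); g = (SOME g. g \<in> T) in
      \<Sum>(p1, q1)\<in>Poly_Mapping.keys f. \<Sum>(p2, q2)\<in>Poly_Mapping.keys g.
        real_of_int (Poly_Mapping.lookup f (p1, q1) * Poly_Mapping.lookup g (p2, q2)) *\<^sub>R
          E (star q1 o\<^sub>L E (star p1 o\<^sub>L p2) o\<^sub>L q2))"

text \<open>
  \<open>c\<^sub>0 X c\<^sub>1 \<cdots> X c\<^sub>m\<close> is sent to
  \<open>\<Sum>\<^sub>j (c\<^sub>0 X \<cdots> X c\<^sub>j\<^sub>-\<^sub>1) \<otimes> (c\<^sub>j X \<cdots> X c\<^sub>m)\<close>, with \<open>j\<close> from \<open>1\<close> to \<open>m\<close>.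
\<close>

definition nc_deriv :: "'h::complex_hilbert_space op \<Rightarrow>
    ('h op list \<Rightarrow>\<^sub>0 int) \<Rightarrow> ('h op \<times> 'h op \<Rightarrow>\<^sub>0 int)" where
  "nc_deriv X = frag_extend (\<lambda>w. \<Sum>j\<in>{1..<length w}.
     frag_of (monomial_value X (take j w), monomial_value X (drop j w)))"

definition free_diff_quot :: "'h::complex_hilbert_space op set \<Rightarrow> 'h op set \<Rightarrow> 'h op \<Rightarrow>
    'h op \<Rightarrow> ('h op \<times> 'h op \<Rightarrow>\<^sub>0 int) set" where
  "free_diff_quot D C X p =
     (THE t. \<exists>f\<in>nc_polys C. nc_eval X f = p \<and> t = tensor_class D (adjoin C X) (nc_deriv X f))"

text \<open>
  Under algebraic freeness the free difference quotient is well defined: it is given by the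
  formal derivative of any polynomial expression.
\<close>

lemma monomial_value_in_adjoin:
  assumes "w \<in> lists C"
  shows "monomial_value X w \<in> adjoin C X"
proof -
  have "monomial_value X w \<in> A" if "unital_star_algebra A" "insert X C \<subseteq> A" for A
    using assms that
    by (induction X w rule: monomial_value.induct) (auto simp: unital_star_algebra_def)
  then show ?thesis by (auto simp: adjoin_def)
qed

lemma blinfun_assoc: "(a o\<^sub>L b) o\<^sub>L c = a o\<^sub>L (b o\<^sub>L c)"
  by (rule blinfun_eqI) simp

lemma monomial_value_Cons:
  "w \<noteq> [] \<Longrightarrow> monomial_value X (c # w) = c o\<^sub>L X o\<^sub>L monomial_value X w"
  by (cases w) auto

lemma monomial_value_split: "\<exists>P Q. \<forall>a. monomial_value X (u @ a # v) = P o\<^sub>L a o\<^sub>L Q"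
proof (induction u)
  case Nil
  show ?case
  proof (cases v)
    case Nil
    then show ?thesis
      by (intro exI[of _ id_blinfun]) (auto intro!: blinfun_eqI)
  next
    case (Cons b w)
    then show ?thesis
      by (intro exI[of _ id_blinfun] exI[of _ "X o\<^sub>L monomial_value X v"])
        (auto intro!: blinfun_eqI)
  qed
next
  case (Cons c u)
  then obtain P Q where "\<forall>a. monomial_value X (u @ a # v) = P o\<^sub>L a o\<^sub>L Q" by blast
  then show ?case
    by (intro exI[of _ "c o\<^sub>L X o\<^sub>L P"] exI[of _ Q])
      (auto simp: monomial_value_Cons intro!: blinfun_eqI)
qed

lemma monomial_value_add:
  "monomial_value X (u @ (a + b) # v) = monomial_value X (u @ a # v) + monomial_value X (u @ b # v)"
proof -
  obtain P Q where "\<forall>a. monomial_value X (u @ a # v) = P o\<^sub>L a o\<^sub>L Q"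
    using monomial_value_split by blast
  then show ?thesis
    by (auto intro!: blinfun_eqI simp: blinfun.add_left blinfun.add_right)
qed

lemma monomial_value_snoc:
  "monomial_value X (u @ [a]) o\<^sub>L d = monomial_value X (u @ [a o\<^sub>L d])"
  by (induction u) (auto simp: monomial_value_Cons blinfun_assoc)

lemma monomial_value_left:
  "d o\<^sub>L monomial_value X (b # v) = monomial_value X ((d o\<^sub>L b) # v)"
  by (cases v) (auto simp: blinfun_assoc)

lemma monomial_value_scale2:
  assumes "clinear_op X" "clinear_op a"
  shows "monomial_value X (u @ scaleC_op z a # b # v) = monomial_value X (u @ a # scaleC_op z b # v)"
proof -
  have *: "a (scaleC z (X x)) = scaleC z (a (X x))" "X (scaleC z x) = scaleC z (X x)" for x
    using assms by (auto simp: clinear_op_def)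
  show ?thesis
  proof (induction u)
    case Nil
    show ?case using assms
      by (cases v) (auto intro!: blinfun_eqI simp: scaleC_op.rep_eq clinear_op_def)
  qed (auto simp: monomial_value_Cons)
qed

lemma group_closure_sum:
  "(\<And>j. j \<in> J \<Longrightarrow> f j \<in> group_closure S) \<Longrightarrow> sum f J \<in> group_closure S"
  by (induction J rule: infinite_finite_induct) (auto intro: group_closure_add)


lemma nc_deriv_of: "nc_deriv X (frag_of w) = (\<Sum>j\<in>{1..<length w}.
     frag_of (monomial_value X (take j w), monomial_value X (drop j w)))"
  by (simp add: nc_deriv_def)

lemma nc_deriv_diff: "nc_deriv X (f - g) = nc_deriv X f - nc_deriv X g"
  by (simp add: nc_deriv_def frag_extend_diff)

lemma tensor_relations_closureI:
  "p \<in> A \<Longrightarrow> p' \<in> A \<Longrightarrow> q \<in> A \<Longrightarrow>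
     frag_of (p + p', q) - frag_of (p, q) - frag_of (p', q) \<in> group_closure (tensor_relations D A)"
  "p \<in> A \<Longrightarrow> q \<in> A \<Longrightarrow> q' \<in> A \<Longrightarrow>
     frag_of (p, q + q') - frag_of (p, q) - frag_of (p, q') \<in> group_closure (tensor_relations D A)"
  "p \<in> A \<Longrightarrow> q \<in> A \<Longrightarrow> d \<in> D \<Longrightarrow>
     frag_of (p o\<^sub>L d, q) - frag_of (p, d o\<^sub>L q) \<in> group_closure (tensor_relations D A)"
  unfolding tensor_relations_def by (rule group_closure.base; blast)+

lemma nc_deriv_relations:
  assumes "clinear_op X" "\<And>c. c \<in> C \<Longrightarrow> clinear_op c" "r \<in> nc_relations C"
    and "\<And>z. scaleC_op z id_blinfun \<in> D" "\<And>w. w \<in> lists C \<Longrightarrow> monomial_value X w \<in> A"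
    "\<And>z c. c \<in> C \<Longrightarrow> scaleC_op z c \<in> C" "\<And>b c. b \<in> C \<Longrightarrow> c \<in> C \<Longrightarrow> b + c \<in> C"
  shows "nc_deriv X r \<in> group_closure (tensor_relations D A)"
  using assms(3) unfolding nc_relations_def
proof (elim UnE CollectE exE conjE)
  fix u v a b
  assume r: "r = frag_of (u @ [a + b] @ v) - frag_of (u @ [a] @ v) - frag_of (u @ [b] @ v)"
    and C: "u \<in> lists C" "v \<in> lists C" "a \<in> C" "b \<in> C"
  let ?t = "\<lambda>c j. frag_of (monomial_value X (take j (u @ c # v)), monomial_value X (drop j (u @ c # v)))"
  have "nc_deriv X r = (\<Sum>j\<in>{1..<length (u @ a # v)}. ?t (a + b) j - ?t a j - ?t b j)"
    unfolding r nc_deriv_diff nc_deriv_of by (simp add: sum_subtractf)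
  also have "\<dots> \<in> group_closure (tensor_relations D A)"
  proof (rule group_closure_sum)
    fix j assume "j \<in> {1..<length (u @ a # v)}"
    show "?t (a + b) j - ?t a j - ?t b j \<in> group_closure (tensor_relations D A)"
    proof (cases "j \<le> length u")
      case True
      then have t: "?t c j =
          frag_of (monomial_value X (take j u), monomial_value X (drop j u @ c # v))" for c
        by simp
      have "monomial_value X (take j u) \<in> A"
        "\<And>c. c \<in> C \<Longrightarrow> monomial_value X (drop j u @ c # v) \<in> A"
        using C(1,2) by (auto intro!: assms(5) dest!: in_set_takeD in_set_dropD)
      then show ?thesis
        unfolding t monomial_value_add using C(3,4) by (intro tensor_relations_closureI)
    next
      case False
      define k where "k = j - Suc (length u)"
      have t: "?t c j =
          frag_of (monomial_value X (u @ c # take k v), monomial_value X (drop k v))" for c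
        using False by (simp add: k_def take_Cons' drop_Cons')
      have "monomial_value X (drop k v) \<in> A"
        "\<And>c. c \<in> C \<Longrightarrow> monomial_value X (u @ c # take k v) \<in> A"
        using C(1,2) by (auto intro!: assms(5) dest!: in_set_takeD in_set_dropD)
      then show ?thesis
        unfolding t monomial_value_add using C(3,4) by (intro tensor_relations_closureI)
    qed
  qed
  finally show ?thesis .
next
  fix u v a b z
  assume r: "r = frag_of (u @ [scaleC_op z a, b] @ v) - frag_of (u @ [a, scaleC_op z b] @ v)"
    and C: "u \<in> lists C" "v \<in> lists C" "a \<in> C" "b \<in> C"
  have lin: "clinear_op X" "clinear_op a"
    using assms(1,2) C by auto
  let ?w = "u @ scaleC_op z a # b # v" and ?w' = "u @ a # scaleC_op z b # v"
  let ?t = "\<lambda>w j. frag_of (monomial_value X (take j w), monomial_value X (drop j w))"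
  have "nc_deriv X r = (\<Sum>j\<in>{1..<length ?w}. ?t ?w j - ?t ?w' j)"
    unfolding r nc_deriv_diff nc_deriv_of by (simp add: sum_subtractf)
  also have "\<dots> \<in> group_closure (tensor_relations D A)"
  proof (rule group_closure_sum)
    fix j assume "j \<in> {1..<length ?w}"
    consider "j \<le> length u" | "j = Suc (length u)" | "j \<ge> Suc (Suc (length u))" by linarith
    then show "?t ?w j - ?t ?w' j \<in> group_closure (tensor_relations D A)"
    proof cases
      case 1
      then show ?thesis by (simp add: monomial_value_scale2[OF lin])
    next
      case 2
      let ?d = "scaleC_op z id_blinfun :: 'a op"
      have e: "scaleC_op z a = a o\<^sub>L ?d" "scaleC_op z b = ?d o\<^sub>L b"
        using lin by (auto intro!: blinfun_eqI simp: scaleC_op.rep_eq clinear_op_def)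
      have "monomial_value X (u @ [a]) \<in> A" "monomial_value X (b # v) \<in> A"
        using C assms(5) by auto
      moreover have "?t ?w j = frag_of (monomial_value X (u @ [a]) o\<^sub>L ?d, monomial_value X (b # v))"
        "?t ?w' j = frag_of (monomial_value X (u @ [a]), ?d o\<^sub>L monomial_value X (b # v))"
        using 2 by (simp_all add: e monomial_value_snoc monomial_value_left)
      ultimately show ?thesis
        using assms(4) by (simp only: tensor_relations_closureI)
    next
      case 3
      define k where "k = j - Suc (Suc (length u))"
      have "take j (u @ c # d # v) = u @ c # d # take k v" "drop j (u @ c # d # v) = drop k v" for c d
        using 3 by (simp_all add: k_def take_Cons' drop_Cons')
      then show ?thesis by (simp add: monomial_value_scale2[OF lin])
    qed
  qed
  finally show ?thesis .
qed

lemma nc_deriv_formal_tensors: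
  assumes "f \<in> nc_polys C"
  shows "nc_deriv X f \<in> formal_tensors (adjoin C X)"
proof -
  have sub: "take j x \<in> lists C" "drop j x \<in> lists C" if "x \<in> lists C" for x :: "'a op list" and j
    using that by (auto dest!: in_set_takeD in_set_dropD)
  let ?A = "adjoin C X"
  have "Poly_Mapping.keys (\<Sum>j\<in>{1..<length w}.
     frag_of (monomial_value X (take j w), monomial_value X (drop j w))) \<subseteq> ?A \<times> ?A"
    if "w \<in> lists C" for w
    using sub[OF that] by (intro order.trans[OF keys_sum]) (auto intro!: monomial_value_in_adjoin)
  with assms show ?thesis
    unfolding formal_tensors_def nc_polys_def nc_deriv_def
    by (auto dest!: subsetD[OF keys_frag_extend])
qed

lemma equiv_tensor_rel: "equiv (formal_tensors A) (tensor_rel D A)"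
proof (rule equivI)
  let ?G = "group_closure (tensor_relations D A)"
  have "g - f \<in> ?G" if "f - g \<in> ?G" for f g
    using that group_closure_minus_iff[of "f - g"] by simp
  then show "sym (tensor_rel D A)"
    unfolding sym_def tensor_rel_def by blast
  have "f - h \<in> ?G" if "f - g \<in> ?G" "g - h \<in> ?G" for f g h
    using group_closure_add[OF that] by simp
  then show "trans (tensor_rel D A)"
    unfolding trans_def tensor_rel_def by blast
qed (auto simp: tensor_rel_def refl_on_def)

lemma free_diff_quot_eval:
  assumes "von_neumann_algebra C" "von_neumann_algebra D" "clinear_op X"
    and "algebraically_free C X" "f \<in> nc_polys C"
  shows "free_diff_quot D C X (nc_eval X f) = tensor_class D (adjoin C X) (nc_deriv X f)"
  unfolding free_diff_quot_def
proof (rule the_equality)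
  show "\<exists>g\<in>nc_polys C. nc_eval X g = nc_eval X f \<and> 
     tensor_class D (adjoin C X) (nc_deriv X f) = tensor_class D (adjoin C X) (nc_deriv X g)"
    using assms by blast
next
  fix t assume "\<exists>g\<in>nc_polys C. nc_eval X g = nc_eval X f \<and> t = tensor_class D (adjoin C X) (nc_deriv X g)"
  then obtain g where g: "g \<in> nc_polys C" "nc_eval X g = nc_eval X f"
    "t = tensor_class D (adjoin C X) (nc_deriv X g)" by blast
  let ?A = "adjoin C X"
  have C: "clinear_op c" "scaleC_op z c \<in> C" "b \<in> C \<Longrightarrow> b + c \<in> C" if "c \<in> C" for b c z
    using that assms(1) by (auto simp: von_neumann_algebra_def unital_star_algebra_def)
  have D: "scaleC_op z id_blinfun \<in> D" for z
    using assms(2) by (auto simp: von_neumann_algebra_def unital_star_algebra_def)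
  have "nc_deriv X r \<in> group_closure (tensor_relations D ?A)"
    if "r \<in> group_closure (nc_relations C)" for r
    using that
  proof induction
    case (base s)
    then show ?case
      using nc_deriv_relations[OF assms(3) C(1) _ D monomial_value_in_adjoin C(2,3)]
      by (auto simp: nc_deriv_def)
  qed (auto simp: nc_deriv_diff intro: group_closure.diff)
  moreover have "g - f \<in> group_closure (nc_relations C)"
    using assms(4,5) g by (auto simp: algebraically_free_def)
  ultimately have "(nc_deriv X g, nc_deriv X f) \<in> tensor_rel D ?A"
    using nc_deriv_formal_tensors[OF g(1)] nc_deriv_formal_tensors[OF assms(5)]
    by (auto simp: tensor_rel_def simp flip: nc_deriv_diff)
  from equiv_class_eq[OF equiv_tensor_rel this]
  show "t = tensor_class D ?A (nc_deriv X f)"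
    using g(3) by (simp add: tensor_class_def)
qed

section \<open>Conjugate variables and free Fisher information\<close>

definition is_conjugate_variable ::
  "'h::complex_hilbert_space op set \<Rightarrow> 'h op set \<Rightarrow> ('h op \<Rightarrow> 'h op) \<Rightarrow>
    'h op set \<Rightarrow> 'h op \<Rightarrow> (nat \<Rightarrow> 'h op) set \<Rightarrow> bool" where
  "is_conjugate_variable M D E C X J \<longleftrightarrow>
     J \<in> L2_closure M E (adjoin C X) \<and>
     (\<forall>p\<in>adjoin C X. L2_inner E J (L2_embed M E p) =
        tensor_inner E (tensor_class D (adjoin C X) (frag_of (id_blinfun, id_blinfun)))
          (free_diff_quot D C X p))"

definition conjugate_variable ::
  "'h::complex_hilbert_space op set \<Rightarrow> 'h op set \<Rightarrow> ('h op \<Rightarrow> 'h op) \<Rightarrow>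
    'h op set \<Rightarrow> 'h op \<Rightarrow> (nat \<Rightarrow> 'h op) set" where
  "conjugate_variable M D E C X = (THE J. is_conjugate_variable M D E C X J)"

definition vN_without :: "'h::complex_hilbert_space op set \<Rightarrow> nat \<Rightarrow> (nat \<Rightarrow> 'h op) \<Rightarrow>
    nat \<Rightarrow> 'h op set" where
  "vN_without B n X j = vN_generated (B \<union> X ` ({1..n} - {j}))"

definition free_Fisher ::
  "'h::complex_hilbert_space op set \<Rightarrow> 'h op set \<Rightarrow> ('h op \<Rightarrow> 'h op) \<Rightarrow>
    'h op set \<Rightarrow> nat \<Rightarrow> (nat \<Rightarrow> 'h op) \<Rightarrow> 'h op" where
  "free_Fisher M D E B n X =
     (\<Sum>j\<in>{1..n}. let J = conjugate_variable M D E (vN_without B n X j) (X j) in L2_inner E J J)"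

end

theory Submission
  imports Defs
begin

text \<open>
  Since \<open>\<partial>X\<^sub>j = 1 \<otimes> 1\<close>, the conjugate variable \<open>J\<^sub>j\<close> satisfies \<open>E\<^sub>D(J\<^sub>j\<^sup>* X\<^sub>j) = 1\<close>. The Cauchy--Schwarz
  inequality of the Hilbert module then gives \<open>\<parallel>h\<parallel>\<^sup>2 \<le> a\<^sub>j \<langle>h, b\<^sub>j h\<rangle>\<close> for every vector \<open>h\<close>, where
  \<open>a\<^sub>j = \<parallel>E\<^sub>D(X\<^sub>j\<^sup>2)\<parallel>\<close> and \<open>b\<^sub>j = E\<^sub>D(J\<^sub>j\<^sup>* J\<^sub>j)\<close>. The Cauchy--Schwarz inequality for the numbers
  \<open>\<surd>a\<^sub>j\<close> and \<open>\<surd>\<langle>h, b\<^sub>j h\<rangle>\<close> sums these up to the claim.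
\<close>

section \<open>Inner products and adjoints\<close>

lemma cinner_add_left: "cinner (x + y) (z :: 'h::complex_hilbert_space) = cinner x z + cinner y z"
  by (metis cinner_add_right cinner_commute complex_cnj_add)

lemma cinner_scaleC_left: "cinner (scaleC c x) (y :: 'h::complex_hilbert_space) = cnj c * cinner x y"
  by (metis cinner_commute cinner_scaleC_right complex_cnj_mult)

lemma scaleR_scaleC: "r *\<^sub>R x = scaleC (complex_of_real r) (x :: 'h::complex_hilbert_space)"
  by (simp add: scaleC_of_real)

lemma cinner_scaleR_right: "cinner x (r *\<^sub>R (y :: 'h::complex_hilbert_space)) = of_real r * cinner x y"
  by (simp add: scaleR_scaleC cinner_scaleC_right)

lemma cinner_scaleR_left: "cinner (r *\<^sub>R x) (y :: 'h::complex_hilbert_space) = of_real r * cinner x y"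
  by (simp add: scaleR_scaleC cinner_scaleC_left)

lemma cinner_minus_right: "cinner x (- (y :: 'h::complex_hilbert_space)) = - cinner x y"
  using cinner_scaleR_right[of x "-1" y] by simp

lemma cinner_minus_left: "cinner (- x) (y :: 'h::complex_hilbert_space) = - cinner x y"
  using cinner_scaleR_left[of "-1" x y] by simp

lemma cinner_diff_right: "cinner x (y - (z :: 'h::complex_hilbert_space)) = cinner x y - cinner x z"
  using cinner_add_right[of x y "- z"] by (simp add: cinner_minus_right)

lemma cinner_diff_left: "cinner (x - y) (z :: 'h::complex_hilbert_space) = cinner x z - cinner y z"
  using cinner_add_left[of x "- y" z] by (simp add: cinner_minus_left)

lemma cinner_zero_right [simp]: "cinner x (0 :: 'h::complex_hilbert_space) = 0"
  using cinner_scaleR_right[of x 0 0] by simp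

lemma cinner_zero_left [simp]: "cinner 0 (x :: 'h::complex_hilbert_space) = 0"
  using cinner_scaleR_left[of 0 0 x] by simp

lemma cinner_self: "cinner x x = complex_of_real ((norm (x :: 'h::complex_hilbert_space))\<^sup>2)"
proof (rule complex_eqI)
  show "Im (cinner x x) = Im (complex_of_real ((norm x)\<^sup>2))"
    using arg_cong[OF cinner_commute[of x x], of Im] by simp
  have "0 \<le> Re (cinner x x)"
    by (metis norm_eq_sqrt_cinner norm_ge_zero real_sqrt_ge_0_iff)
  then show "Re (cinner x x) = Re (complex_of_real ((norm x)\<^sup>2))"
    by (simp add: norm_eq_sqrt_cinner[where 'a = 'h])
qed

text \<open>The class axioms include the triangle inequality of the norm; squaring it and expanding
  leaves exactly this bound on the cross term.\<close>

lemma Re_cinner_le: "Re (cinner x y) \<le> norm x * norm (y :: 'h::complex_hilbert_space)"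
proof -
  have "cinner (x + y) (x + y) = cinner x x + cinner y y + (cinner x y + cnj (cinner x y))"
    by (simp add: cinner_add_left cinner_add_right flip: cinner_commute[of y x])
  then have "(norm (x + y))\<^sup>2 = (norm x)\<^sup>2 + (norm y)\<^sup>2 + 2 * Re (cinner x y)"
    unfolding cinner_self by (metis complex_add_cnj of_real_add of_real_eq_iff)
  moreover have "(norm (x + y))\<^sup>2 \<le> (norm x + norm y)\<^sup>2"
    by (intro power_mono norm_triangle_ineq norm_ge_zero)
  ultimately show ?thesis by (simp add: power2_sum)
qed

lemma cinner_Cauchy_Schwarz: "cmod (cinner x y) \<le> norm x * norm (y :: 'h::complex_hilbert_space)"
proof (cases "cinner x y = 0")
  case False
  \<comment> \<open>A unimodular factor on \<open>y\<close> turns the inner product into its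
    modulus, so the bound on real parts suffices.\<close>
  let ?c = "cnj (sgn (cinner x y))"
  have "cinner x (scaleC ?c y) = cmod (cinner x y)"
    unfolding cinner_scaleC_right
    using False complex_norm_square[of "cinner x y"]
    by (simp add: sgn_eq power2_eq_square field_simps)
  with Re_cinner_le[of x "scaleC ?c y"] show ?thesis
    using False by (simp add: norm_scaleC norm_sgn)
qed simp

lemma bounded_linear_cinner_right: "bounded_linear (cinner (x :: 'h::complex_hilbert_space))"
  by (rule bounded_linear_intro[where K = "norm x"])
    (use cinner_Cauchy_Schwarz[of x] in
      \<open>auto simp: cinner_add_right cinner_scaleR_right scaleR_conv_of_real mult.commute\<close>)

lemma cinner_right_eqI:
  assumes "\<And>z. cinner z x = cinner z (y :: 'h::complex_hilbert_space)"
  shows "x = y"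
proof -
  have "cinner (x - y) (x - y) = 0"
    using assms by (simp add: cinner_diff_right)
  then show ?thesis by (simp add: cinner_self)
qed

lemma is_adjoint_unique: "is_adjoint a b \<Longrightarrow> is_adjoint a b' \<Longrightarrow> b = b'"
  unfolding is_adjoint_def by (metis blinfun_eqI cinner_right_eqI)

text \<open>\<open>star\<close> is a definite description, and a bounded real-linear map need not
  have an adjoint. Stars are therefore computed by exhibiting an adjoint.\<close>

lemma star_eqI: "is_adjoint a b \<Longrightarrow> star a = b"
  unfolding star_def by (blast intro: is_adjoint_unique)

lemma is_adjoint_id: "is_adjoint id_blinfun id_blinfun"
  by (simp add: is_adjoint_def)

lemma star_id [simp]: "star id_blinfun = id_blinfun"
  by (intro star_eqI is_adjoint_id)

lemma is_adjoint_sym: "is_adjoint a b \<Longrightarrow> is_adjoint b a"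
  unfolding is_adjoint_def by (metis cinner_commute)

lemma is_adjoint_add: "is_adjoint a a' \<Longrightarrow> is_adjoint b b' \<Longrightarrow> is_adjoint (a + b) (a' + b')"
  by (simp add: is_adjoint_def blinfun.add_left cinner_add_left cinner_add_right)

lemma is_adjoint_diff: "is_adjoint a a' \<Longrightarrow> is_adjoint b b' \<Longrightarrow> is_adjoint (a - b) (a' - b')"
  by (simp add: is_adjoint_def blinfun.diff_left cinner_diff_left cinner_diff_right)

lemma is_adjoint_scaleC: "is_adjoint a a' \<Longrightarrow> is_adjoint (scaleC_op c a) (scaleC_op (cnj c) a')"
  by (simp add: is_adjoint_def scaleC_op.rep_eq cinner_scaleC_left cinner_scaleC_right)

lemma is_adjoint_comp: "is_adjoint a a' \<Longrightarrow> is_adjoint b b' \<Longrightarrow> is_adjoint (a o\<^sub>L b) (b' o\<^sub>L a')"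
  by (simp add: is_adjoint_def)

lemma scaleR_scaleC_op: "r *\<^sub>R a = scaleC_op (complex_of_real r) (a :: 'h::complex_hilbert_space op)"
  by (intro blinfun_eqI) (simp add: scaleC_op.rep_eq scaleR_scaleC blinfun.scaleR_left)

lemma is_adjoint_scaleR: "is_adjoint a a' \<Longrightarrow> is_adjoint (r *\<^sub>R a) (r *\<^sub>R a')"
  using is_adjoint_scaleC[of a a' "of_real r"] by (simp add: scaleR_scaleC_op)

text \<open>Polarization: real values of the quadratic form at \<open>x + y\<close> and at
  \<open>x + i y\<close> control the imaginary and the real parts of the mixed terms.\<close>

lemma is_adjoint_self_iff_real:
  assumes "clinear_op a"
  shows "is_adjoint a a \<longleftrightarrow> (\<forall>x. cinner x (a x) \<in> \<real>)"
proof
  assume "is_adjoint a a"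
  then show "\<forall>x. cinner x (a x) \<in> \<real>"
    by (metis Reals_cnj_iff cinner_commute is_adjoint_def)
next
  assume real: "\<forall>x. cinner x (a x) \<in> \<real>"
  have lin: "a (scaleC c x) = scaleC c (a x)" for c x
    using assms by (simp add: clinear_op_def)
  have "cinner (a x) y = cinner x (a y)" for x y
  proof -
    have 1: "cinner x (a y) + cinner y (a x) \<in> \<real>" for x y
    proof -
      have "cinner x (a y) + cinner y (a x) =
          cinner (x + y) (a (x + y)) - cinner x (a x) - cinner y (a y)"
        by (simp add: blinfun.add_right cinner_add_left cinner_add_right)
      then show ?thesis using real by (metis Reals_diff)
    qed
    \<comment> \<open>This is the previous relation with \<open>i y\<close> for \<open>y\<close>.
      The first relation makes the imaginary parts of the mixed terms opposite, this one makes their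
      real parts equal.\<close>
    have "\<i> * cinner x (a y) - \<i> * cinner y (a x) \<in> \<real>"
      using 1[of x "scaleC \<i> y"] by (simp add: lin cinner_scaleC_left cinner_scaleC_right)
    with 1[of x y] have "cinner x (a y) = cnj (cinner y (a x))"
      by (auto simp: complex_is_Real_iff complex_eq_iff)
    then show ?thesis by (metis cinner_commute)
  qed
  then show "is_adjoint a a" by (simp add: is_adjoint_def)
qed

lemma positive_op_comp_star:
  assumes "is_adjoint a b" "clinear_op a" "clinear_op b"
  shows "positive_op (b o\<^sub>L a)"
proof -
  have "cinner x (b (a x)) = complex_of_real ((norm (a x))\<^sup>2)" for x
    using assms(1) unfolding is_adjoint_def by (metis cinner_self)
  then show ?thesis using assms(2,3) by (simp add: positive_op_def clinear_op_def)
qed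

lemma Re_quadratic_le:
  fixes a :: "'h::complex_hilbert_space op"
  shows "Re (cinner x (a x)) \<le> norm a * (norm x)\<^sup>2"
proof -
  have "Re (cinner x (a x)) \<le> norm x * norm (a x)"
    by (rule Re_cinner_le)
  also have "\<dots> \<le> norm x * (norm a * norm x)"
    by (intro mult_left_mono norm_blinfun norm_ge_zero)
  finally show ?thesis by (simp add: power2_eq_square mult_ac)
qed

lemma tendsto_quadratic:
  fixes a :: "nat \<Rightarrow> 'h::complex_hilbert_space op"
  assumes "a \<longlonglongrightarrow> b"
  shows "(\<lambda>k. cinner x (a k y)) \<longlonglongrightarrow> cinner x (b y)"
  by (intro bounded_linear.tendsto[OF bounded_linear_cinner_right] blinfun.tendsto assms tendsto_const)

lemma positive_op_limit:
  assumes "a \<longlonglongrightarrow> b" "\<And>k. positive_op (a k)" "clinear_op b"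
  shows "positive_op b"
  unfolding positive_op_def
proof (intro conjI allI)
  fix x
  note lim = tendsto_quadratic[OF assms(1), of x x]
  show "cinner x (b x) \<in> \<real>"
    using assms(2) by (intro Lim_in_closed_set[OF closed_complex_Reals _ _ lim])
      (auto simp: positive_op_def)
  show "0 \<le> Re (cinner x (b x))"
    using assms(2) by (intro tendsto_lowerbound[OF tendsto_Re[OF lim]]) (auto simp: positive_op_def)
qed (rule assms)

section \<open>Star algebras\<close>

lemma unital_star_algebraD:
  assumes "unital_star_algebra A"
  shows "a \<in> A \<Longrightarrow> clinear_op a" "id_blinfun \<in> A" "a \<in> A \<Longrightarrow> b \<in> A \<Longrightarrow> a + b \<in> A"
    "a \<in> A \<Longrightarrow> scaleC_op c a \<in> A" "a \<in> A \<Longrightarrow> b \<in> A \<Longrightarrow> a o\<^sub>L b \<in> A"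
    "a \<in> A \<Longrightarrow> r *\<^sub>R a \<in> A" "a \<in> A \<Longrightarrow> b \<in> A \<Longrightarrow> a - b \<in> A"
    "a \<in> A \<Longrightarrow> is_adjoint a (star a)" "a \<in> A \<Longrightarrow> star a \<in> A" "0 \<in> A"
proof -
  have ex: "\<exists>b\<in>A. is_adjoint a b" if "a \<in> A" for a
    using assms that by (auto simp: unital_star_algebra_def)
  show "a \<in> A \<Longrightarrow> is_adjoint a (star a)" "a \<in> A \<Longrightarrow> star a \<in> A"
    using ex star_eqI by blast+
  show scaleR: "a \<in> A \<Longrightarrow> r *\<^sub>R a \<in> A" for a r
    using assms by (auto simp: unital_star_algebra_def scaleR_scaleC_op)
  show "a \<in> A \<Longrightarrow> b \<in> A \<Longrightarrow> a - b \<in> A"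
    using assms scaleR[of b "-1"] unfolding unital_star_algebra_def
    by (metis diff_conv_add_uminus scaleR_minus1_left)
  show "0 \<in> A"
    using assms scaleR[of id_blinfun 0] by (auto simp: unital_star_algebra_def)
qed (use assms in \<open>auto simp: unital_star_algebra_def\<close>)

lemma unital_star_algebra_sum:
  assumes "unital_star_algebra A" "\<And>j. j \<in> J \<Longrightarrow> f j \<in> A"
  shows "sum f J \<in> A"
  using assms(2)
  by (induction J rule: infinite_finite_induct) (auto intro: unital_star_algebraD[OF assms(1)])

text \<open>Nonemptiness matters: the empty intersection is the whole type, which also contains maps
  that are not complex-linear.\<close>

lemma unital_star_algebra_Inter:
  assumes "\<And>N. N \<in> \<N> \<Longrightarrow> unital_star_algebra N" "\<N> \<noteq> {}"
  shows "unital_star_algebra (\<Inter>\<N>)"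
  unfolding unital_star_algebra_def
proof (intro conjI ballI allI)
  fix a assume a: "a \<in> \<Inter>\<N>"
  show "clinear_op a"
    using a assms by (auto dest: unital_star_algebraD)
  show "\<exists>b\<in>\<Inter>\<N>. is_adjoint a b"
    using a assms by (intro bexI[of _ "star a"]) (auto dest: unital_star_algebraD)
qed (use assms(1) in \<open>auto dest: unital_star_algebraD\<close>)

lemma von_neumann_algebra_generated:
  assumes "von_neumann_algebra M" "S \<subseteq> M"
  shows "von_neumann_algebra (vN_generated S)"
  unfolding von_neumann_algebra_def
proof
  show "unital_star_algebra (vN_generated S)"
    unfolding vN_generated_def
    using assms by (intro unital_star_algebra_Inter) (auto simp: von_neumann_algebra_def)
  show "wot_closed (vN_generated S)"
    unfolding wot_closed_def
  proof (intro allI impI)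
    fix a
    assume a: "clinear_op a \<and> (\<forall>F e. finite F \<and> 0 < e \<longrightarrow>
      (\<exists>b\<in>vN_generated S. \<forall>(x, y)\<in>F. cmod (cinner x ((a - b) y)) < e))"
    show "a \<in> vN_generated S"
      unfolding vN_generated_def
    proof (clarify)
      fix N assume N: "von_neumann_algebra N" "S \<subseteq> N"
      then have "vN_generated S \<subseteq> N" by (auto simp: vN_generated_def)
      then have "\<forall>F e. finite F \<and> 0 < e \<longrightarrow> (\<exists>b\<in>N. \<forall>(x, y)\<in>F. cmod (cinner x ((a - b) y)) < e)"
        using a by (meson subsetD)
      then show "a \<in> N"
        using a N by (auto simp: von_neumann_algebra_def wot_closed_def)
    qed
  qed
qed

lemma vN_generated_subset:
  assumes "von_neumann_algebra M" "S \<subseteq> M"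
  shows "vN_generated S \<subseteq> M"
  using assms by (auto simp: vN_generated_def)

lemma unital_star_algebra_adjoin:
  assumes "unital_star_algebra M" "C \<subseteq> M" "X \<in> M"
  shows "unital_star_algebra (adjoin C X)"
  unfolding adjoin_def using assms by (intro unital_star_algebra_Inter) auto

lemma adjoin_subset:
  assumes "unital_star_algebra M" "C \<subseteq> M" "X \<in> M"
  shows "adjoin C X \<subseteq> M"
  using assms by (auto simp: adjoin_def)

section \<open>Norm limits inside von Neumann algebras\<close>

lemma clinear_op_limit:
  assumes "a \<longlonglongrightarrow> b" "\<And>k. clinear_op (a k)"
  shows "clinear_op b"
  unfolding clinear_op_def
proof (intro allI)
  fix c x
  have "bounded_linear (scaleC c :: 'a \<Rightarrow> 'a)"
  proof (rule bounded_linear_intro[where K = "cmod c"])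
    show "scaleC c (r *\<^sub>R x) = r *\<^sub>R scaleC c x" for r and x :: 'a
      by (simp add: scaleR_scaleC scaleC_scaleC mult.commute)
  qed (auto simp: scaleC_add_right norm_scaleC mult.commute)
  then have "(\<lambda>k. scaleC c (a k x)) \<longlonglongrightarrow> scaleC c (b x)"
    by (rule bounded_linear.tendsto) (intro blinfun.tendsto assms tendsto_const)
  moreover have "(\<lambda>k. a k (scaleC c x)) \<longlonglongrightarrow> b (scaleC c x)"
    by (intro blinfun.tendsto assms tendsto_const)
  ultimately show "b (scaleC c x) = scaleC c (b x)"
    using assms(2) by (intro LIMSEQ_unique[of "\<lambda>k. a k (scaleC c x)"]) (simp_all add: clinear_op_def)
qed

text \<open>Norm convergence implies convergence of every matrix coefficient. A weak neighbourhood
  tests only finitely many of them, so a single late index serves all. This keeps the values of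
  \<open>L2_inner\<close> in \<open>D\<close>.\<close>

lemma von_neumann_algebra_limit:
  assumes "von_neumann_algebra N" "a \<longlonglongrightarrow> b" "\<And>k. a k \<in> N"
  shows "b \<in> N"
proof -
  have "clinear_op b"
    using assms(2) by (rule clinear_op_limit)
      (use assms in \<open>auto simp: von_neumann_algebra_def dest: unital_star_algebraD\<close>)
  moreover have "\<exists>c\<in>N. \<forall>(x, y)\<in>F. cmod (cinner x ((b - c) y)) < e" if "finite F" "0 < e" for F e
  proof -
    have "\<forall>\<^sub>F k in sequentially. cmod (cinner x ((b - a k) y)) < e" for x y
    proof -
      have "(\<lambda>k. cinner x ((b - a k) y)) \<longlonglongrightarrow> cinner x ((b - b) y)"
        by (intro tendsto_quadratic tendsto_diff tendsto_const assms)
      then have "(\<lambda>k. cmod (cinner x ((b - a k) y))) \<longlonglongrightarrow> 0"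
        by (simp add: tendsto_norm_zero)
      then show ?thesis using \<open>0 < e\<close> by (rule order_tendstoD)
    qed
    then have "\<forall>\<^sub>F k in sequentially. \<forall>p\<in>F. cmod (cinner (fst p) ((b - a k) (snd p))) < e"
      using that by (intro eventually_ball_finite) auto
    then obtain k where "\<forall>p\<in>F. cmod (cinner (fst p) ((b - a k) (snd p))) < e"
      using eventually_happens'[OF sequentially_bot] by blast
    then show ?thesis using assms(3) by (intro bexI[of _ "a k"]) auto
  qed
  ultimately show ?thesis
    using assms(1) by (auto simp: von_neumann_algebra_def wot_closed_def)
qed

section \<open>Conditional expectations and the seminorm\<close>

lemmas blinfun_compose_distribs =
  bounded_bilinear.add_left[OF bounded_bilinear_blinfun_compose]
  bounded_bilinear.add_right[OF bounded_bilinear_blinfun_compose]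
  bounded_bilinear.diff_left[OF bounded_bilinear_blinfun_compose]
  bounded_bilinear.diff_right[OF bounded_bilinear_blinfun_compose]
  bounded_bilinear.scaleR_left[OF bounded_bilinear_blinfun_compose]
  bounded_bilinear.scaleR_right[OF bounded_bilinear_blinfun_compose]

lemma id_blinfun_compose [simp]: "id_blinfun o\<^sub>L a = a" "a o\<^sub>L id_blinfun = a"
  by (auto intro: blinfun_eqI)

locale vN_expectation =
  fixes M D :: "'h::complex_hilbert_space op set" and E :: "'h op \<Rightarrow> 'h op"
  assumes vN_M: "von_neumann_algebra M" and vN_D: "von_neumann_algebra D" and D_subset: "D \<subseteq> M"
    and cond_exp: "conditional_expectation M D E"
begin

lemma star_algebra_M: "unital_star_algebra M" and star_algebra_D: "unital_star_algebra D"
  using vN_M vN_D by (auto simp: von_neumann_algebra_def)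

lemmas M_intros [intro, simp] = unital_star_algebraD(2-7,9,10)[OF star_algebra_M]
lemmas D_intros [intro, simp] = unital_star_algebraD(2-7,9,10)[OF star_algebra_D]
lemmas M_clinear = unital_star_algebraD(1)[OF star_algebra_M]
lemmas M_adjoint = unital_star_algebraD(8)[OF star_algebra_M]

lemma D_in_M [intro, simp]: "d \<in> D \<Longrightarrow> d \<in> M"
  using D_subset by blast

lemma star_M:
  assumes "a \<in> M" "b \<in> M"
  shows "star (a + b) = star a + star b" "star (a - b) = star a - star b"
    "star (a o\<^sub>L b) = star b o\<^sub>L star a" "star (star a) = a" "star (r *\<^sub>R a) = r *\<^sub>R star a"
    "star (scaleC_op c a) = scaleC_op (cnj c) (star a)"
  using assms by (auto intro!: star_eqI is_adjoint_add is_adjoint_diff is_adjoint_comp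
      is_adjoint_scaleR is_adjoint_scaleC is_adjoint_sym[OF M_adjoint] M_adjoint)

lemma E_in_D [intro, simp]: "x \<in> M \<Longrightarrow> E x \<in> D"
  and E_add: "x \<in> M \<Longrightarrow> y \<in> M \<Longrightarrow> E (x + y) = E x + E y"
  and E_scaleC: "x \<in> M \<Longrightarrow> E (scaleC_op c x) = scaleC_op c (E x)"
  and E_pos: "x \<in> pos_cone M \<Longrightarrow> E x \<in> pos_cone D"
  and E_fix: "d \<in> D \<Longrightarrow> E d = d"
  and E_module: "d \<in> D \<Longrightarrow> x \<in> M \<Longrightarrow> d' \<in> D \<Longrightarrow> E (d o\<^sub>L x o\<^sub>L d') = d o\<^sub>L E x o\<^sub>L d'"
  using cond_exp by (auto simp: conditional_expectation_def)

lemma E_scaleR: "x \<in> M \<Longrightarrow> E (r *\<^sub>R x) = r *\<^sub>R E x"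
  by (simp add: scaleR_scaleC_op E_scaleC)

lemma E_diff: "x \<in> M \<Longrightarrow> y \<in> M \<Longrightarrow> E (x - y) = E x - E y"
  using E_add[of x "(-1) *\<^sub>R y"] E_scaleR[of y "-1"] M_intros(5)[of y "-1"] by simp

lemma E_zero: "E 0 = 0"
  using E_fix[of 0] by simp

lemma E_module_left: "d \<in> D \<Longrightarrow> x \<in> M \<Longrightarrow> E (d o\<^sub>L x) = d o\<^sub>L E x"
  using E_module[of d x id_blinfun] by simp

lemma E_module_right: "d \<in> D \<Longrightarrow> x \<in> M \<Longrightarrow> E (x o\<^sub>L d) = E x o\<^sub>L d"
  using E_module[of id_blinfun x d] by simp

lemma E_star_self_positive: "x \<in> M \<Longrightarrow> positive_op (E (star x o\<^sub>L x))"
proof -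
  assume x: "x \<in> M"
  then have "star x o\<^sub>L x \<in> pos_cone M"
    unfolding pos_cone_def
    by (auto intro!: positive_op_comp_star M_adjoint M_clinear)
  then show ?thesis using E_pos by (auto simp: pos_cone_def)
qed

text \<open>Only positivity of \<open>E\<close> is at hand. Adding \<open>norm x\<close> times the
  identity makes \<open>x\<close> positive; its image is then positive, hence self-adjoint, and the
  shift is subtracted again.\<close>

lemma E_self_adjoint:
  assumes "x \<in> M" "is_adjoint x x"
  shows "is_adjoint (E x) (E x)"
proof -
  let ?p = "norm x *\<^sub>R id_blinfun + x"
  have "positive_op ?p"
    unfolding positive_op_def
  proof (intro conjI allI)
    fix h
    have "cinner h (x h) \<in> \<real>"
      using assms by (simp add: is_adjoint_self_iff_real M_clinear)
    then show "cinner h (?p h) \<in> \<real>"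
      by (auto simp: blinfun.add_left blinfun.scaleR_left cinner_add_right cinner_scaleR_right
          cinner_self)
    \<comment> \<open>\<open>Re_quadratic_le\<close> bounds quadratic forms from above; applied to
      \<open>- x\<close> it gives the lower bound that the shift compensates.\<close>
    have "norm (- x) = norm x" by simp
    then show "0 \<le> Re (cinner h (?p h))"
      using Re_quadratic_le[of h "- x"]
      by (simp add: blinfun.add_left blinfun.scaleR_left blinfun.minus_left cinner_add_right
          cinner_scaleR_right cinner_self cinner_minus_right)
  qed (use assms in \<open>auto intro!: M_clinear\<close>)
  then have "?p \<in> pos_cone M"
    using assms by (auto simp: pos_cone_def)
  then have "positive_op (E ?p)"
    using E_pos by (auto simp: pos_cone_def)
  then have "is_adjoint (E ?p) (E ?p)"
    by (simp add: is_adjoint_self_iff_real positive_op_def)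
  from is_adjoint_diff[OF this is_adjoint_scaleR[OF is_adjoint_id, of "norm x"]]
  show ?thesis
    using assms by (simp add: E_add E_scaleR E_fix)
qed

text \<open>The self-adjoint elements \<open>x + star x\<close> and \<open>i (x - star x)\<close>
  yield two linear relations between the matrix coefficients of \<open>E x\<close> and
  \<open>E (star x)\<close>.\<close>

lemma E_adjoint:
  assumes "x \<in> M"
  shows "is_adjoint (E x) (E (star x))"
  unfolding is_adjoint_def
proof (intro allI)
  fix u v
  note adj = M_adjoint[OF assms] is_adjoint_sym[OF M_adjoint[OF assms]]
  have "is_adjoint (x + star x) (x + star x)"
    using is_adjoint_add[OF adj] by (simp add: add.commute)
  from E_self_adjoint[OF _ this]
  have 1: "cinner (E x u) v + cinner (E (star x) u) v = cinner u (E x v) + cinner u (E (star x) v)"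
    using assms by (simp add: E_add is_adjoint_def blinfun.add_left cinner_add_left cinner_add_right)
  have e: "scaleC_op (- \<i>) (star x - x) = scaleC_op \<i> (x - star x)"
  proof (intro blinfun_eqI)
    fix y
    have "scaleC (- \<i>) (star x y - x y) = scaleC (- \<i>) (scaleC (-1) (x y - star x y))"
      using scaleC_of_real[of "-1" "x y - star x y"] by simp
    then show "blinfun_apply (scaleC_op (- \<i>) (star x - x)) y = scaleC_op \<i> (x - star x) y"
      by (simp add: scaleC_op.rep_eq blinfun.diff_left scaleC_scaleC)
  qed
  have "is_adjoint (scaleC_op \<i> (x - star x)) (scaleC_op \<i> (x - star x))"
    using is_adjoint_scaleC[OF is_adjoint_diff[OF adj], of \<i>] by (simp add: e)
  from E_self_adjoint[OF _ this]
  have "cnj \<i> * (cinner (E x u) v - cinner (E (star x) u) v) =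
      \<i> * (cinner u (E x v) - cinner u (E (star x) v))"
    using assms by (simp add: E_diff E_scaleC is_adjoint_def scaleC_op.rep_eq blinfun.diff_left
        cinner_diff_left cinner_diff_right cinner_scaleC_left cinner_scaleC_right
        del: complex_cnj_i)
  \<comment> \<open>Cancelling \<open>i\<close> against \<open>cnj i = - i\<close> reverses the sign
    on the right. Adding the relations 1 and 2 then isolates the claim.\<close>
  then have 2: "cinner (E x u) v - cinner (E (star x) u) v =
      cinner u (E (star x) v) - cinner u (E x v)"
    by (simp add: complex_eq_iff)
  from 1 2 show "cinner (E x u) v = cinner u (E (star x) v)"
    by (simp add: complex_eq_iff)
qed

lemma star_E: "x \<in> M \<Longrightarrow> star (E x) = E (star x)"
  by (intro star_eqI E_adjoint)

text \<open>
  The Cauchy--Schwarz inequality of the Hilbert module comes from positivity of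
  \<open>E (w\<^sup>* w)\<close> for \<open>w = x - t y E(y\<^sup>* x)\<close>, with the real parameter \<open>t\<close> chosen optimally.
\<close>

lemma E_Cauchy_Schwarz:
  assumes x: "x \<in> M" and y: "y \<in> M"
  shows "(norm (E (star y o\<^sub>L x) h))\<^sup>2 \<le>
    norm (E (star y o\<^sub>L y)) * Re (cinner h (E (star x o\<^sub>L x) h))"
proof -
  define T where "T = E (star y o\<^sub>L x)"
  define N where "N = norm (E (star y o\<^sub>L y))"
  define P where "P = Re (cinner h (E (star x o\<^sub>L x) h))"
  define \<tau> where "\<tau> = (norm (T h))\<^sup>2"
  have T: "T \<in> D" using x y by (simp add: T_def)
  have adjT: "star T = E (star x o\<^sub>L y)"
    using x y by (simp add: T_def star_E star_M)
  have adj: "is_adjoint T (star T)"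
    using T by (intro M_adjoint) auto
  have main: "0 \<le> P - 2 * t * \<tau> + t\<^sup>2 * (N * \<tau>)" for t
  proof -
    let ?w = "x - t *\<^sub>R (y o\<^sub>L T)"
    have w: "star ?w o\<^sub>L ?w = (star x o\<^sub>L x) - t *\<^sub>R ((star x o\<^sub>L y) o\<^sub>L T)
        - t *\<^sub>R (star T o\<^sub>L (star y o\<^sub>L x)) + t\<^sup>2 *\<^sub>R (star T o\<^sub>L (star y o\<^sub>L y) o\<^sub>L T)"
      using x y T by (simp add: star_M blinfun_compose_distribs blinfun_assoc algebra_simps
          power2_eq_square)
    have "E (star ?w o\<^sub>L ?w) = E (star x o\<^sub>L x) - t *\<^sub>R (star T o\<^sub>L T)
        - t *\<^sub>R (star T o\<^sub>L T) + t\<^sup>2 *\<^sub>R (star T o\<^sub>L E (star y o\<^sub>L y) o\<^sub>L T)"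
      unfolding w using x y T
      by (simp add: E_add E_diff E_scaleR E_module E_module_left E_module_right adjT
          flip: T_def)
    moreover have "0 \<le> Re (cinner h (E (star ?w o\<^sub>L ?w) h))"
      using E_star_self_positive[of ?w] x y T by (auto simp: positive_op_def)
    moreover have "cinner h (star T v) = cinner (T h) v" for v
      using adj by (simp add: is_adjoint_def)
    ultimately have "0 \<le> P - 2 * t * \<tau> + t\<^sup>2 * Re (cinner (T h) (E (star y o\<^sub>L y) (T h)))"
      by (simp add: blinfun.add_left blinfun.diff_left blinfun.scaleR_left cinner_add_right
          cinner_diff_right cinner_scaleR_right cinner_self P_def \<tau>_def)
    \<comment> \<open>Bounding the quadratic form of \<open>E (star y o\<^sub>L y)\<close> by its
      norm leaves a real polynomial in \<open>t\<close> with coefficients made from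
      \<open>P\<close>, \<open>N\<close> and \<open>\<tau>\<close>.\<close>
    also have "\<dots> \<le> P - 2 * t * \<tau> + t\<^sup>2 * (N * \<tau>)"
      unfolding N_def \<tau>_def by (intro add_left_mono mult_left_mono Re_quadratic_le) auto
    finally show ?thesis .
  qed
  have "\<tau> \<le> N * P"
  proof (cases "N = 0")
    case True
    have "\<tau> = 0"
    proof (rule ccontr)
      assume "\<tau> \<noteq> 0"
      \<comment> \<open>For \<open>N = 0\<close> the polynomial is affine in \<open>t\<close>, and
        at this \<open>t\<close> its value is \<open>-1\<close>.\<close>
      with main[of "(P + 1) / (2 * \<tau>)"] True show False by simp
    qed
    with True show ?thesis by simp
  next
    case False
    then have "N > 0" by (simp add: N_def)
    \<comment> \<open>At the minimiser \<open>1 / N\<close> the bound reads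
      \<open>0 \<le> P - \<tau> / N\<close>.\<close>
    with main[of "1 / N"] show ?thesis
      by (simp add: field_simps power2_eq_square)
  qed
  then show ?thesis by (simp add: \<tau>_def N_def P_def T_def)
qed

section \<open>The seminorm \<open>norm2\<close> and its triangle inequality\<close>

lemma norm2_nonneg [simp]: "0 \<le> norm2 E x"
  by (simp add: norm2_def)

lemma norm2_sq: "(norm2 E x)\<^sup>2 = norm (E (star x o\<^sub>L x))"
  by (simp add: norm2_def)

text \<open>Bounding the quadratic form in the vectorwise Cauchy-Schwarz inequality by a norm gives
  this scalar version, on which the continuity estimates rest.\<close>

lemma norm_E_le:
  assumes "x \<in> M" "y \<in> M"
  shows "norm (E (star y o\<^sub>L x)) \<le> norm2 E y * norm2 E x"
proof (rule norm_blinfun_bound)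
  fix h
  have "(norm (E (star y o\<^sub>L x) h))\<^sup>2 \<le> (norm2 E y)\<^sup>2 * ((norm2 E x)\<^sup>2 * (norm h)\<^sup>2)"
    using E_Cauchy_Schwarz[OF assms, of h]
    unfolding norm2_sq by (rule order_trans) (intro mult_left_mono Re_quadratic_le norm_ge_zero)
  then have "(norm (E (star y o\<^sub>L x) h))\<^sup>2 \<le> (norm2 E y * norm2 E x * norm h)\<^sup>2"
    by (simp add: power_mult_distrib mult_ac)
  then show "norm (E (star y o\<^sub>L x) h) \<le> norm2 E y * norm2 E x * norm h"
    by (rule power2_le_imp_le) simp
qed simp

lemma norm2_triangle:
  assumes "x \<in> M" "y \<in> M"
  shows "norm2 E (x + y) \<le> norm2 E x + norm2 E y"
proof -
  have "E (star (x + y) o\<^sub>L (x + y)) =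
      E (star x o\<^sub>L x) + E (star x o\<^sub>L y) + (E (star y o\<^sub>L x) + E (star y o\<^sub>L y))"
    using assms by (simp add: star_M blinfun_compose_distribs E_add)
  then have "(norm2 E (x + y))\<^sup>2 \<le> norm (E (star x o\<^sub>L x)) + norm (E (star x o\<^sub>L y))
      + (norm (E (star y o\<^sub>L x)) + norm (E (star y o\<^sub>L y)))"
    unfolding norm2_sq by (metis norm_triangle_le add_mono norm_triangle_ineq)
  also have "\<dots> \<le> norm2 E x * norm2 E x + norm2 E x * norm2 E y
      + (norm2 E y * norm2 E x + norm2 E y * norm2 E y)"
    using assms by (intro add_mono norm_E_le)
  also have "\<dots> = (norm2 E x + norm2 E y)\<^sup>2"
    by (simp add: power2_eq_square algebra_simps)
  finally show ?thesis by (rule power2_le_imp_le) simp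
qed

lemma norm2_commute:
  assumes "x \<in> M" "y \<in> M"
  shows "norm2 E (x - y) = norm2 E (y - x)"
proof -
  have "star (x - y) o\<^sub>L (x - y) = star (y - x) o\<^sub>L (y - x)"
    using assms by (simp add: star_M blinfun_compose_distribs)
  then show ?thesis by (simp add: norm2_def)
qed

lemma norm2_triangle3:
  assumes "x \<in> M" "y \<in> M" "z \<in> M"
  shows "norm2 E (x - z) \<le> norm2 E (x - y) + norm2 E (y - z)"
  using norm2_triangle[of "x - y" "y - z"] assms by simp

lemma norm2_abs_diff:
  assumes "x \<in> M" "y \<in> M"
  shows "\<bar>norm2 E x - norm2 E y\<bar> \<le> norm2 E (x - y)"
  using norm2_triangle[of "x - y" y] norm2_triangle[of "y - x" x] norm2_commute[OF assms] assms
  by simp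

section \<open>The completion\<close>

lemma L2_CauchyD:
  assumes "x \<in> L2_Cauchy M E"
  shows "x k \<in> M" "0 < e \<Longrightarrow> \<exists>K. \<forall>k\<ge>K. \<forall>l\<ge>K. norm2 E (x k - x l) < e"
  using assms by (auto simp: L2_Cauchy_def)

lemma L2_Cauchy_const: "p \<in> M \<Longrightarrow> (\<lambda>_. p) \<in> L2_Cauchy M E"
  by (auto simp: L2_Cauchy_def norm2_def E_zero)

lemma L2_Cauchy_bounded:
  assumes "x \<in> L2_Cauchy M E"
  obtains C where "C > 0" "\<And>k. norm2 E (x k) \<le> C"
proof -
  have "Cauchy (\<lambda>k. norm2 E (x k))"
    unfolding Cauchy_def dist_real_def
    using L2_CauchyD[OF assms] norm2_abs_diff order_le_less_trans by (metis (no_types, lifting))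
  then have "Bseq (\<lambda>k. norm2 E (x k))"
    by (rule Cauchy_Bseq)
  then show thesis
    using that by (auto simp: Bseq_def)
qed

text \<open>\<open>L2_dist\<close> is defined by \<open>lim\<close>, which is informative only for
  convergent sequences. The reverse triangle inequality makes these distances Cauchy.\<close>

lemma L2_dist_convergent:
  assumes "x \<in> L2_Cauchy M E" "y \<in> L2_Cauchy M E"
  shows "convergent (\<lambda>k. norm2 E (x k - y k))"
  unfolding Cauchy_convergent_iff[symmetric] Cauchy_def dist_real_def
proof (intro allI impI)
  fix e :: real assume "0 < e"
  then obtain K L where
    K: "\<And>k l. k \<ge> K \<Longrightarrow> l \<ge> K \<Longrightarrow> norm2 E (x k - x l) < e / 2" and
    L: "\<And>k l. k \<ge> L \<Longrightarrow> l \<ge> L \<Longrightarrow> norm2 E (y k - y l) < e / 2"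
    using L2_CauchyD(2)[OF assms(1), of "e / 2"] L2_CauchyD(2)[OF assms(2), of "e / 2"]
    by (metis half_gt_zero)
  show "\<exists>K. \<forall>k\<ge>K. \<forall>l\<ge>K. \<bar>norm2 E (x k - y k) - norm2 E (x l - y l)\<bar> < e"
  proof (intro exI[of _ "max K L"] allI impI)
    fix k l assume kl: "k \<ge> max K L" "l \<ge> max K L"
    note M = L2_CauchyD(1)[OF assms(1)] L2_CauchyD(1)[OF assms(2)]
    have "\<bar>norm2 E (x k - y k) - norm2 E (x l - y l)\<bar> \<le> norm2 E ((x k - x l) + (y l - y k))"
      using norm2_abs_diff[of "x k - y k" "x l - y l"] M by (simp add: algebra_simps)
    also have "\<dots> \<le> norm2 E (x k - x l) + norm2 E (y l - y k)"
      using M by (intro norm2_triangle) auto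
    also have "\<dots> < e"
      using K[of k l] L[of l k] kl by simp
    finally show "\<bar>norm2 E (x k - y k) - norm2 E (x l - y l)\<bar> < e" .
  qed
qed

text \<open>The two factors are exchanged one at a time, and each error term is estimated by
  \<open>norm_E_le\<close>.\<close>

lemma norm_E_diff_le:
  assumes "x \<in> M" "y \<in> M" "x' \<in> M" "y' \<in> M"
  shows "norm (E (star x o\<^sub>L y) - E (star x' o\<^sub>L y')) \<le>
    norm2 E x * norm2 E (y - y') + norm2 E (x - x') * norm2 E y'"
proof -
  have "E (star x o\<^sub>L y) - E (star x' o\<^sub>L y') = E (star x o\<^sub>L (y - y')) + E (star (x - x') o\<^sub>L y')"
    using assms by (simp add: star_M blinfun_compose_distribs E_diff)
  then show ?thesis
    using assms by (auto intro!: norm_triangle_le add_mono norm_E_le)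
qed

text \<open>This gives the \<open>lim\<close> in \<open>L2_inner\<close> its meaning: the sequence
  is Cauchy in operator norm, and the bounded operators are complete.\<close>

lemma L2_inner_convergent:
  assumes "x \<in> L2_Cauchy M E" "y \<in> L2_Cauchy M E"
  shows "convergent (\<lambda>k. E (star (x k) o\<^sub>L y k))"
  unfolding Cauchy_convergent_iff[symmetric] Cauchy_def dist_norm
proof (intro allI impI)
  fix e :: real assume "0 < e"
  obtain C where C: "C > 0" "\<And>k. norm2 E (x k) \<le> C"
    using L2_Cauchy_bounded[OF assms(1)] by blast
  obtain C' where C': "C' > 0" "\<And>k. norm2 E (y k) \<le> C'"
    using L2_Cauchy_bounded[OF assms(2)] by blast
  \<comment> \<open>Each increment is measured against the bound of the other factor, so that both
    errors contribute \<open>e / 2\<close>.\<close>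
  obtain K where K: "\<And>k l. k \<ge> K \<Longrightarrow> l \<ge> K \<Longrightarrow> norm2 E (x k - x l) < e / (2 * C')"
    using L2_CauchyD(2)[OF assms(1), of "e / (2 * C')"] C' \<open>0 < e\<close> by auto
  obtain L where L: "\<And>k l. k \<ge> L \<Longrightarrow> l \<ge> L \<Longrightarrow> norm2 E (y k - y l) < e / (2 * C)"
    using L2_CauchyD(2)[OF assms(2), of "e / (2 * C)"] C \<open>0 < e\<close> by auto
  show "\<exists>K. \<forall>k\<ge>K. \<forall>l\<ge>K. norm (E (star (x k) o\<^sub>L y k) - E (star (x l) o\<^sub>L y l)) < e"
  proof (intro exI[of _ "max K L"] allI impI)
    fix k l assume kl: "k \<ge> max K L" "l \<ge> max K L"
    note M = L2_CauchyD(1)[OF assms(1)] L2_CauchyD(1)[OF assms(2)]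
    have "norm (E (star (x k) o\<^sub>L y k) - E (star (x l) o\<^sub>L y l)) \<le>
        norm2 E (x k) * norm2 E (y k - y l) + norm2 E (x k - x l) * norm2 E (y l)"
      using M by (intro norm_E_diff_le)
    also have "\<dots> \<le> C * norm2 E (y k - y l) + norm2 E (x k - x l) * C'"
      using C C' by (intro add_mono mult_right_mono mult_left_mono) auto
    also have "\<dots> < C * (e / (2 * C)) + e / (2 * C') * C'"
      using K[of k l] L[of k l] kl C C'
      by (intro add_strict_mono mult_strict_left_mono mult_strict_right_mono) auto
    also have "\<dots> = e" using C C' by simp
    finally show "norm (E (star (x k) o\<^sub>L y k) - E (star (x l) o\<^sub>L y l)) < e" .
  qed
qed

end

text \<open>Names the choice hidden in \<open>L2_inner\<close> and \<open>L2_dist\<close>, so that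
  limits along it can be stated.\<close>

definition L2_rep :: "(nat \<Rightarrow> 'h::complex_hilbert_space op) set \<Rightarrow> nat \<Rightarrow> 'h op" where
  "L2_rep \<xi> = (SOME x. x \<in> \<xi>)"

lemma L2_inner_rep: "L2_inner E \<xi> \<eta> = lim (\<lambda>k. E (star (L2_rep \<xi> k) o\<^sub>L L2_rep \<eta> k))"
  by (simp add: L2_inner_def L2_rep_def Let_def)

lemma L2_dist_rep: "L2_dist E \<xi> \<eta> = lim (\<lambda>k. norm2 E (L2_rep \<xi> k - L2_rep \<eta> k))"
  by (simp add: L2_dist_def L2_rep_def Let_def)

context vN_expectation
begin

section \<open>Classes, their chosen representatives, and limits of inner products\<close>

lemma equiv_L2_rel: "equiv (L2_Cauchy M E) (L2_rel M E)"
proof (rule equivI)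
  show "refl_on (L2_Cauchy M E) (L2_rel M E)"
    by (auto simp: refl_on_def L2_rel_def norm2_def E_zero)
  show "sym (L2_rel M E)"
    by (auto simp: sym_def L2_rel_def L2_CauchyD norm2_commute)
  show "trans (L2_rel M E)"
    unfolding trans_def L2_rel_def
  proof clarsimp
    fix x y z
    assume C: "x \<in> L2_Cauchy M E" "y \<in> L2_Cauchy M E" "z \<in> L2_Cauchy M E"
      and lim: "(\<lambda>k. norm2 E (x k - y k)) \<longlonglongrightarrow> 0" "(\<lambda>k. norm2 E (y k - z k)) \<longlonglongrightarrow> 0"
    show "(\<lambda>k. norm2 E (x k - z k)) \<longlonglongrightarrow> 0"
      by (rule tendsto_sandwich[OF _ _ tendsto_const tendsto_add_zero[OF lim]])
        (use C in \<open>auto intro!: always_eventually norm2_triangle3 dest: L2_CauchyD\<close>)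
  qed
qed (auto simp: L2_rel_def)

lemma L2_rep:
  assumes "\<xi> \<in> L2_space M E"
  shows "L2_rep \<xi> \<in> \<xi>" "L2_rep \<xi> \<in> L2_Cauchy M E" "L2_rep \<xi> k \<in> M"
proof -
  have "\<xi> \<noteq> {}" "\<xi> \<subseteq> L2_Cauchy M E"
    using assms in_quotient_imp_non_empty[OF equiv_L2_rel] in_quotient_imp_subset[OF equiv_L2_rel]
    by (auto simp: L2_space_def)
  then show "L2_rep \<xi> \<in> \<xi>" "L2_rep \<xi> \<in> L2_Cauchy M E"
    unfolding L2_rep_def by (metis some_in_eq subsetD)+
  then show "L2_rep \<xi> k \<in> M" by (simp add: L2_CauchyD)
qed

lemma L2_eqI:
  assumes "\<xi> \<in> L2_space M E" "\<eta> \<in> L2_space M E"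
    and "(\<lambda>k. norm2 E (L2_rep \<xi> k - L2_rep \<eta> k)) \<longlonglongrightarrow> 0"
  shows "\<xi> = \<eta>"
proof -
  have "(L2_rep \<xi>, L2_rep \<eta>) \<in> L2_rel M E"
    using assms L2_rep by (simp add: L2_rel_def)
  then show ?thesis
    using assms(1,2) L2_rep(1)
    by (intro quotient_eqI[OF equiv_L2_rel, of \<xi> \<eta> "L2_rep \<xi>" "L2_rep \<eta>"])
      (simp_all add: L2_space_def)
qed

lemma L2_embed_in_space: "p \<in> M \<Longrightarrow> L2_embed M E p \<in> L2_space M E"
  by (simp add: L2_embed_def L2_space_def quotientI L2_Cauchy_const)

text \<open>The representative chosen for an embedded element need not be constant; it differs from
  the constant sequence by a null sequence.\<close>

lemma L2_rep_embed:
  assumes "p \<in> M"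
  shows "(\<lambda>k. norm2 E (L2_rep (L2_embed M E p) k - p)) \<longlonglongrightarrow> 0"
proof -
  have "((\<lambda>_. p), L2_rep (L2_embed M E p)) \<in> L2_rel M E"
    using L2_rep(1)[OF L2_embed_in_space[OF assms]] by (simp add: L2_embed_def)
  then have "(L2_rep (L2_embed M E p), (\<lambda>_. p)) \<in> L2_rel M E"
    using equiv_L2_rel by (metis equivE symD)
  then show ?thesis by (simp add: L2_rel_def)
qed

lemma L2_inner_tendsto:
  assumes "\<xi> \<in> L2_space M E" "\<eta> \<in> L2_space M E"
  shows "(\<lambda>k. E (star (L2_rep \<xi> k) o\<^sub>L L2_rep \<eta> k)) \<longlonglongrightarrow> L2_inner E \<xi> \<eta>"
  unfolding L2_inner_rep convergent_LIMSEQ_iff[symmetric]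
  by (intro L2_inner_convergent L2_rep assms)

text \<open>The chosen representative of \<open>p\<close> may be replaced by \<open>p\<close>
  itself, because the seminorms along the representative of \<open>\<xi>\<close> are
  bounded.\<close>

lemma L2_inner_embed_tendsto:
  assumes "\<xi> \<in> L2_space M E" "p \<in> M"
  shows "(\<lambda>k. E (star (L2_rep \<xi> k) o\<^sub>L p)) \<longlonglongrightarrow> L2_inner E \<xi> (L2_embed M E p)"
proof -
  let ?x = "L2_rep \<xi>" and ?y = "L2_rep (L2_embed M E p)"
  obtain C where C: "C > 0" "\<And>k. norm2 E (?x k) \<le> C"
    using L2_Cauchy_bounded[OF L2_rep(2)[OF assms(1)]] by blast
  note M = L2_rep(3)[OF assms(1)] L2_rep(3)[OF L2_embed_in_space[OF assms(2)]] assms(2)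
  have "norm (E (star (?x k) o\<^sub>L ?y k) - E (star (?x k) o\<^sub>L p)) \<le> C * norm2 E (?y k - p)" for k
  proof -
    \<comment> \<open>Equal first entries remove the second error term of
      \<open>norm_E_diff_le\<close>, since \<open>norm2 E 0 = 0\<close>.\<close>
    have "norm (E (star (?x k) o\<^sub>L ?y k) - E (star (?x k) o\<^sub>L p)) \<le>
        norm2 E (?x k) * norm2 E (?y k - p)"
      using norm_E_diff_le[of "?x k" "?y k" "?x k" p] M by (simp add: norm2_def E_zero)
    also have "\<dots> \<le> C * norm2 E (?y k - p)"
      using C by (intro mult_right_mono) auto
    finally show ?thesis .
  qed
  moreover have "(\<lambda>k. C * norm2 E (?y k - p)) \<longlonglongrightarrow> 0"
    using tendsto_mult_right_zero[OF L2_rep_embed[OF assms(2)]] .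
  ultimately have "(\<lambda>k. E (star (?x k) o\<^sub>L ?y k) - E (star (?x k) o\<^sub>L p)) \<longlonglongrightarrow> 0"
    by (rule Lim_null_comparison[OF always_eventually[OF allI]])
  from tendsto_diff[OF L2_inner_tendsto[OF assms(1) L2_embed_in_space[OF assms(2)]] this]
  show ?thesis by simp
qed

lemma L2_inner_self_in_pos_cone:
  assumes "\<xi> \<in> L2_space M E"
  shows "L2_inner E \<xi> \<xi> \<in> pos_cone D"
proof -
  note lim = L2_inner_tendsto[OF assms assms] and x = L2_rep(3)[OF assms]
  have "L2_inner E \<xi> \<xi> \<in> D"
    using x by (intro von_neumann_algebra_limit[OF vN_D lim]) auto
  moreover from this have "positive_op (L2_inner E \<xi> \<xi>)"
    using x by (intro positive_op_limit[OF lim] E_star_self_positive M_clinear) auto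
  ultimately show ?thesis by (simp add: pos_cone_def)
qed

text \<open>The inequality passes to the limit from elements of \<open>M\<close>. It keeps the
  quadratic form of \<open>L2_inner E \<xi> \<xi>\<close> instead of its norm, because the goal is
  an inequality in the operator order.\<close>

lemma L2_Cauchy_Schwarz:
  assumes "\<xi> \<in> L2_space M E" "p \<in> M"
  shows "(cmod (cinner h (L2_inner E \<xi> (L2_embed M E p) h)))\<^sup>2 \<le>
    norm (E (star p o\<^sub>L p)) * Re (cinner h (L2_inner E \<xi> \<xi> h)) * (norm h)\<^sup>2"
proof (rule LIMSEQ_le)
  let ?x = "L2_rep \<xi>"
  show "(\<lambda>k. (cmod (cinner h (E (star (?x k) o\<^sub>L p) h)))\<^sup>2) \<longlonglongrightarrow>
      (cmod (cinner h (L2_inner E \<xi> (L2_embed M E p) h)))\<^sup>2"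
    by (intro tendsto_intros tendsto_quadratic L2_inner_embed_tendsto assms)
  show "(\<lambda>k. norm (E (star p o\<^sub>L p)) * Re (cinner h (E (star (?x k) o\<^sub>L ?x k) h)) * (norm h)\<^sup>2) \<longlonglongrightarrow>
      norm (E (star p o\<^sub>L p)) * Re (cinner h (L2_inner E \<xi> \<xi> h)) * (norm h)\<^sup>2"
    by (intro tendsto_intros tendsto_quadratic L2_inner_tendsto assms)
  have "(cmod (cinner h (E (star x o\<^sub>L p) h)))\<^sup>2 \<le>
      norm (E (star p o\<^sub>L p)) * Re (cinner h (E (star x o\<^sub>L x) h)) * (norm h)\<^sup>2" if x: "x \<in> M" for x
  proof -
    \<comment> \<open>Moving the operator to the other side exchanges \<open>x\<close> and
      \<open>p\<close>, so that \<open>E_Cauchy_Schwarz\<close> puts the norm on \<open>p\<close>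
      and the quadratic form on \<open>x\<close>.\<close>
    have "is_adjoint (E (star p o\<^sub>L x)) (E (star x o\<^sub>L p))"
      using E_adjoint[of "star p o\<^sub>L x"] x assms(2) by (simp add: star_M)
    then have "cinner h (E (star x o\<^sub>L p) h) = cinner (E (star p o\<^sub>L x) h) h"
      by (simp add: is_adjoint_def)
    then have "cmod (cinner h (E (star x o\<^sub>L p) h)) \<le> norm (E (star p o\<^sub>L x) h) * norm h"
      by (simp add: cinner_Cauchy_Schwarz)
    then have "(cmod (cinner h (E (star x o\<^sub>L p) h)))\<^sup>2 \<le> (norm (E (star p o\<^sub>L x) h))\<^sup>2 * (norm h)\<^sup>2"
      by (metis norm_ge_zero power_mono power_mult_distrib)
    also have "\<dots> \<le> norm (E (star p o\<^sub>L p)) * Re (cinner h (E (star x o\<^sub>L x) h)) * (norm h)\<^sup>2"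
      by (intro mult_right_mono E_Cauchy_Schwarz x assms) auto
    finally show ?thesis .
  qed
  then show "\<exists>N. \<forall>k\<ge>N. (cmod (cinner h (E (star (?x k) o\<^sub>L p) h)))\<^sup>2 \<le>
      norm (E (star p o\<^sub>L p)) * Re (cinner h (E (star (?x k) o\<^sub>L ?x k) h)) * (norm h)\<^sup>2"
    using L2_rep(3)[OF assms(1)] by blast
qed

lemma L2_dist_embed_less:
  assumes "\<xi> \<in> L2_space M E" "p \<in> M" "L2_dist E \<xi> (L2_embed M E p) < e"
  shows "\<forall>\<^sub>F k in sequentially. norm2 E (L2_rep \<xi> k - p) < e"
proof -
  let ?x = "L2_rep \<xi>" and ?y = "L2_rep (L2_embed M E p)"
  note y = L2_embed_in_space[OF assms(2)]
  have "(\<lambda>k. norm2 E (?x k - ?y k)) \<longlonglongrightarrow> L2_dist E \<xi> (L2_embed M E p)"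
    unfolding L2_dist_rep convergent_LIMSEQ_iff[symmetric]
    by (intro L2_dist_convergent L2_rep assms y)
  from tendsto_add[OF this L2_rep_embed[OF assms(2)]]
  have "(\<lambda>k. norm2 E (?x k - ?y k) + norm2 E (?y k - p)) \<longlonglongrightarrow> L2_dist E \<xi> (L2_embed M E p)"
    by simp
  then have "\<forall>\<^sub>F k in sequentially. norm2 E (?x k - ?y k) + norm2 E (?y k - p) < e"
    using assms(3) by (rule order_tendstoD)
  then show ?thesis
    by eventually_elim
      (use norm2_triangle3[OF L2_rep(3)[OF assms(1)] L2_rep(3)[OF y] assms(2)] in
        \<open>fastforce intro: order_le_less_trans\<close>)
qed

text \<open>The difference of the two classes is orthogonal to \<open>A\<close> and is approximated
  by elements of \<open>A\<close>, hence is orthogonal to itself.\<close>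

lemma L2_closure_eqI:
  assumes A: "unital_star_algebra A" "A \<subseteq> M"
    and mem: "\<xi> \<in> L2_closure M E A" "\<eta> \<in> L2_closure M E A"
    and inner: "\<And>p. p \<in> A \<Longrightarrow> L2_inner E \<xi> (L2_embed M E p) = L2_inner E \<eta> (L2_embed M E p)"
  shows "\<xi> = \<eta>"
proof (rule L2_eqI)
  show sp: "\<xi> \<in> L2_space M E" "\<eta> \<in> L2_space M E"
    using mem by (auto simp: L2_closure_def)
  define z where "z k = L2_rep \<xi> k - L2_rep \<eta> k" for k
  have zM: "z k \<in> M" for k
    using sp by (simp add: z_def L2_rep)
  have M: "p \<in> M" if "p \<in> A" for p using that A by blast
  have orth: "(\<lambda>k. E (star (z k) o\<^sub>L p)) \<longlonglongrightarrow> 0" if p: "p \<in> A" for p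
  proof -
    have "(\<lambda>k. E (star (L2_rep \<xi> k) o\<^sub>L p) - E (star (L2_rep \<eta> k) o\<^sub>L p)) \<longlonglongrightarrow> 0"
      using tendsto_diff[OF L2_inner_embed_tendsto[OF sp(1) M[OF p]]
          L2_inner_embed_tendsto[OF sp(2) M[OF p]]] inner[OF p] by simp
    moreover have "E (star (z k) o\<^sub>L p) = E (star (L2_rep \<xi> k) o\<^sub>L p) - E (star (L2_rep \<eta> k) o\<^sub>L p)" for k
      using L2_rep(3)[OF sp(1)] L2_rep(3)[OF sp(2)] M[OF p]
      by (simp add: z_def star_M blinfun_compose_distribs E_diff)
    ultimately show ?thesis by simp
  qed
  obtain C1 where C1: "C1 > 0" "\<And>k. norm2 E (L2_rep \<xi> k) \<le> C1"
    using L2_Cauchy_bounded[OF L2_rep(2)[OF sp(1)]] by blast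
  obtain C2 where C2: "C2 > 0" "\<And>k. norm2 E (L2_rep \<eta> k) \<le> C2"
    using L2_Cauchy_bounded[OF L2_rep(2)[OF sp(2)]] by blast
  have C: "norm2 E (z k) \<le> C1 + C2" for k
    using norm2_triangle3[of "L2_rep \<xi> k" 0 "L2_rep \<eta> k"] norm2_commute[of 0 "L2_rep \<eta> k"]
      L2_rep(3)[OF sp(1)] L2_rep(3)[OF sp(2)] C1(2)[of k] C2(2)[of k] by (simp add: z_def)
  have small: "\<forall>\<^sub>F k in sequentially. (norm2 E (z k))\<^sup>2 < e" if "e > 0" for e
  proof -
    \<comment> \<open>Chosen so that the error \<open>(C1 + C2) * (2 * d)\<close> below equals
      \<open>e / 2\<close>.\<close>
    define d where "d = e / (4 * (C1 + C2))"
    have d: "d > 0" using that C1 C2 by (simp add: d_def)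
    from mem d obtain p q where p: "p \<in> A" "L2_dist E \<xi> (L2_embed M E p) < d"
      and q: "q \<in> A" "L2_dist E \<eta> (L2_embed M E q) < d"
      unfolding L2_closure_def by blast
    have pq: "p - q \<in> A" using A(1) p q by (blast intro: unital_star_algebraD)
    have "\<forall>\<^sub>F k in sequentially. norm (E (star (z k) o\<^sub>L (p - q))) < e / 2"
      by (rule order_tendstoD(2)[OF tendsto_norm_zero[OF orth[OF pq]]]) (use \<open>e > 0\<close> in simp)
    with L2_dist_embed_less[OF sp(1) M[OF p(1)] p(2)] L2_dist_embed_less[OF sp(2) M[OF q(1)] q(2)]
    show ?thesis
    proof eventually_elim
      case (elim k)
      have near: "norm2 E (z k - (p - q)) \<le> 2 * d"
      proof -
        have "norm2 E (z k - (p - q)) = norm2 E ((L2_rep \<xi> k - p) + (q - L2_rep \<eta> k))"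
          by (simp add: z_def algebra_simps)
        also have "\<dots> \<le> norm2 E (L2_rep \<xi> k - p) + norm2 E (q - L2_rep \<eta> k)"
          using L2_rep(3)[OF sp(1)] L2_rep(3)[OF sp(2)] M p q by (intro norm2_triangle) auto
        also have "norm2 E (q - L2_rep \<eta> k) = norm2 E (L2_rep \<eta> k - q)"
          using L2_rep(3)[OF sp(2)] M q by (intro norm2_commute) auto
        finally show ?thesis using elim by simp
      qed
      \<comment> \<open>With \<open>m = p - q\<close> the first summand is small because
        \<open>z k\<close> is within \<open>2 * d\<close> of \<open>m\<close>, the second by
        asymptotic orthogonality to \<open>A\<close>.\<close>
      have "E (star (z k) o\<^sub>L z k) = E (star (z k) o\<^sub>L (z k - m)) + E (star (z k) o\<^sub>L m)"
        if "m \<in> M" for m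
        using zM[of k] that by (simp add: blinfun_compose_distribs E_diff)
      from this[OF M[OF pq]]
      have "(norm2 E (z k))\<^sup>2 \<le>
          norm (E (star (z k) o\<^sub>L (z k - (p - q)))) + norm (E (star (z k) o\<^sub>L (p - q)))"
        unfolding norm2_sq by (metis norm_triangle_ineq)
      also have "norm (E (star (z k) o\<^sub>L (z k - (p - q)))) \<le> norm2 E (z k) * norm2 E (z k - (p - q))"
        using zM[of k] M[OF pq] by (intro norm_E_le) auto
      also have "\<dots> \<le> (C1 + C2) * (2 * d)"
        using C near C1 C2 by (intro mult_mono) auto
      also have "\<dots> = e / 2"
        using add_pos_pos[OF C1(1) C2(1)] by (simp add: d_def field_simps)
      finally show ?case using elim by simp
    qed
  qed
  have "(\<lambda>k. (norm2 E (z k))\<^sup>2) \<longlonglongrightarrow> 0"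
    using small by (simp add: tendsto_iff)
  from tendsto_real_sqrt[OF this]
  show "(\<lambda>k. norm2 E (L2_rep \<xi> k - L2_rep \<eta> k)) \<longlonglongrightarrow> 0"
    by (simp add: z_def)
qed

end

section \<open>The pairing on the balanced tensor product\<close>

text \<open>The additive extension of \<open>v\<close> to the free abelian group;
  \<open>tensor_inner\<close> is a nested pair of such extensions.\<close>

definition frag_eval :: "('a \<Rightarrow> 'b::real_vector) \<Rightarrow> ('a \<Rightarrow>\<^sub>0 int) \<Rightarrow> 'b" where
  "frag_eval v f = (\<Sum>w\<in>Poly_Mapping.keys f. real_of_int (Poly_Mapping.lookup f w) *\<^sub>R v w)"

lemma frag_eval_superset:
  assumes "finite S" "Poly_Mapping.keys f \<subseteq> S"
  shows "frag_eval v f = (\<Sum>w\<in>S. real_of_int (Poly_Mapping.lookup f w) *\<^sub>R v w)"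
  unfolding frag_eval_def using assms by (intro sum.mono_neutral_left) (auto simp: in_keys_iff)

lemma frag_eval_of [simp]: "frag_eval v (frag_of w) = v w"
  by (simp add: frag_eval_def)

lemma frag_eval_diff: "frag_eval v (f - g) = frag_eval v f - frag_eval v g"
proof -
  let ?S = "Poly_Mapping.keys f \<union> Poly_Mapping.keys g"
  have "Poly_Mapping.keys (f - g) \<subseteq> ?S"
    by (rule keys_diff)
  then show ?thesis
    by (simp add: frag_eval_superset[of ?S] lookup_minus scaleR_left_diff_distrib sum_subtractf)
qed

lemma frag_eval_cong:
  assumes "\<And>w. w \<in> Poly_Mapping.keys f \<Longrightarrow> v w = v' w"
  shows "frag_eval v f = frag_eval v' f"
  unfolding frag_eval_def using assms by (intro sum.cong) auto

text \<open>Universal property of the balanced tensor product: a biadditive balanced map kills the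
  generating relations, hence the subgroup they generate, and descends to classes.\<close>

lemma frag_eval_tensor_class:
  assumes add_left: "\<And>p p' q. p \<in> A \<Longrightarrow> p' \<in> A \<Longrightarrow> q \<in> A \<Longrightarrow> v (p + p', q) = v (p, q) + v (p', q)"
    and add_right: "\<And>p q q'. p \<in> A \<Longrightarrow> q \<in> A \<Longrightarrow> q' \<in> A \<Longrightarrow> v (p, q + q') = v (p, q) + v (p, q')"
    and balanced: "\<And>p q d. p \<in> A \<Longrightarrow> q \<in> A \<Longrightarrow> d \<in> D \<Longrightarrow> v (p o\<^sub>L d, q) = v (p, d o\<^sub>L q)"
    and f: "f \<in> tensor_class D A g"
  shows "frag_eval v f = frag_eval v g"
proof -
  have zero: "frag_eval v r = 0" if "r \<in> group_closure (tensor_relations D A)" for r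
    using that
  proof induction
    case (base s)
    then show ?case
      by (auto simp: tensor_relations_def frag_eval_diff add_left add_right balanced
          simp del: frag_of_eq)
        (auto simp: frag_eval_def)
  qed (simp add: frag_eval_diff)
  have "g - f \<in> group_closure (tensor_relations D A)"
    using f by (simp add: tensor_class_def tensor_rel_def)
  from zero[OF this] show ?thesis by (simp add: frag_eval_diff)
qed

context vN_expectation
begin

text \<open>\<open>tensor_inner\<close> works with an unknown representative \<open>f\<close> of the
  class of \<open>1 \<otimes> 1\<close>. Both slots are maps that descend to classes, so
  \<open>f\<close> may be replaced by \<open>1 \<otimes> 1\<close>, first on the right and then on
  the left.\<close>

lemma tensor_inner_one_one:
  assumes "unital_star_algebra A" "A \<subseteq> M"
  defines "T \<equiv> tensor_class D A (frag_of (id_blinfun, id_blinfun))"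
  shows "tensor_inner E T T = id_blinfun"
proof -
  define f where "f = (SOME f. f \<in> T)"
  have M: "a \<in> M" if "a \<in> A" for a using that assms by blast
  have one: "frag_of (id_blinfun, id_blinfun) \<in> formal_tensors A"
    using assms(1) by (simp add: formal_tensors_def unital_star_algebraD)
  then have "frag_of (id_blinfun, id_blinfun) \<in> T"
    unfolding T_def tensor_class_def by (rule equiv_class_self[OF equiv_tensor_rel])
  then have f: "f \<in> tensor_class D A (frag_of (id_blinfun, id_blinfun))"
    unfolding f_def T_def by (rule someI)
  then have keys: "Poly_Mapping.keys f \<subseteq> A \<times> A"
    by (simp add: tensor_class_def tensor_rel_def formal_tensors_def)
  have right: "frag_eval (\<lambda>(p2, q2). E (star q1 o\<^sub>L E (star p1 o\<^sub>L p2) o\<^sub>L q2)) f =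
      E (star q1 o\<^sub>L E (star p1))" if "p1 \<in> A" "q1 \<in> A" for p1 q1
  proof -
    \<comment> \<open>Right modularity moves \<open>d\<close> out of the inner expectation and in
      front of \<open>q2\<close>, which is balancedness of the right slot.\<close>
    have "E (star p1 o\<^sub>L (p o\<^sub>L d)) = E (star p1 o\<^sub>L p) o\<^sub>L d" if "p \<in> A" "d \<in> D" for p d
      using that \<open>p1 \<in> A\<close> M E_module_right[of d "star p1 o\<^sub>L p"] by (simp add: blinfun_assoc)
    then show ?thesis
      using that M
      by (subst frag_eval_tensor_class[OF _ _ _ f])
        (simp_all add: blinfun_compose_distribs E_add blinfun_assoc)
  qed
  have "tensor_inner E T T = frag_eval (\<lambda>(p1, q1).
      frag_eval (\<lambda>(p2, q2). E (star q1 o\<^sub>L E (star p1 o\<^sub>L p2) o\<^sub>L q2)) f) f"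
    by (simp add: tensor_inner_def frag_eval_def scaleR_sum_right case_prod_beta flip: f_def)
  also have "\<dots> = frag_eval (\<lambda>(p1, q1). E (star q1 o\<^sub>L E (star p1))) f"
    using keys by (intro frag_eval_cong) (auto simp: right)
  \<comment> \<open>In the left slot \<open>star (p o\<^sub>L d)\<close> starts with
    \<open>star d\<close>, which left modularity pulls out next to \<open>star q\<close>. At
    \<open>1 \<otimes> 1\<close> the remaining value is \<open>E (E 1) = 1\<close>.\<close>
  also have "\<dots> = id_blinfun"
    using M
    by (subst frag_eval_tensor_class[OF _ _ _ f])
      (auto simp: star_M blinfun_compose_distribs E_add E_module_left blinfun_assoc E_fix)
  finally show ?thesis .
qed

section \<open>Conjugate variables\<close>

text \<open>Two candidates have the same pairings with \<open>adjoin C X\<close>. Uniqueness is what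
  makes the definite description \<open>conjugate_variable\<close> usable.\<close>

lemma is_conjugate_variable_unique:
  assumes "C \<subseteq> M" "X \<in> M" "is_conjugate_variable M D E C X J" "is_conjugate_variable M D E C X J'"
  shows "J = J'"
  using assms(3,4) unfolding is_conjugate_variable_def
  by (intro L2_closure_eqI[OF unital_star_algebra_adjoin[OF star_algebra_M assms(1,2)]
        adjoin_subset[OF star_algebra_M assms(1,2)]]) auto

lemma is_conjugate_variable_conjugate_variable:
  assumes "C \<subseteq> M" "X \<in> M" "\<exists>J. is_conjugate_variable M D E C X J"
  shows "is_conjugate_variable M D E C X (conjugate_variable M D E C X)"
  unfolding conjugate_variable_def
  using assms(3) is_conjugate_variable_unique[OF assms(1,2)] by (metis theI)

lemma conjugate_variable_inner:
  assumes "von_neumann_algebra C" "C \<subseteq> M" "X \<in> M" "algebraically_free C X"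
    and "is_conjugate_variable M D E C X J"
  shows "L2_inner E J (L2_embed M E X) = id_blinfun"
proof -
  let ?one = "id_blinfun :: 'h op" and ?A = "adjoin C X"
  have one: "?one \<in> C"
    using assms(1) by (auto simp: von_neumann_algebra_def unital_star_algebraD)
  \<comment> \<open>The list \<open>[1, 1]\<close> encodes the monomial \<open>1 X 1\<close>, that
    is \<open>X\<close>; its formal derivative has the single summand \<open>j = 1\<close>, namely
    \<open>1 \<otimes> 1\<close>.\<close>
  have "free_diff_quot D C X (nc_eval X (frag_of [?one, ?one])) =
      tensor_class D ?A (nc_deriv X (frag_of [?one, ?one]))"
    using one assms by (intro free_diff_quot_eval vN_D M_clinear) (auto simp: nc_polys_def)
  then have "free_diff_quot D C X X = tensor_class D ?A (frag_of (?one, ?one))"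
    by (simp add: nc_eval_def nc_deriv_of)
  moreover have "X \<in> ?A"
    by (auto simp: adjoin_def)
  ultimately show ?thesis
    using assms(5) tensor_inner_one_one[OF unital_star_algebra_adjoin[OF star_algebra_M assms(2,3)]
        adjoin_subset[OF star_algebra_M assms(2,3)]]
    by (auto simp: is_conjugate_variable_def)
qed

lemma conjugate_variable_lower_bound:
  assumes "von_neumann_algebra C" "C \<subseteq> M" "X \<in> M" "star X = X" "algebraically_free C X"
    and "is_conjugate_variable M D E C X J"
  shows "(norm h)\<^sup>2 \<le> norm (E (X o\<^sub>L X)) * Re (cinner h (L2_inner E J J h))"
proof (cases "h = 0")
  case False
  have "J \<in> L2_space M E"
    using assms(6) by (simp add: is_conjugate_variable_def L2_closure_def)
  from L2_Cauchy_Schwarz[OF this assms(3), of h]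
  \<comment> \<open>The left side is the squared modulus of \<open>cinner h h\<close>, as the
    pairing of \<open>J\<close> with \<open>X\<close> is the identity. A factor
    \<open>(norm h)\<^sup>2\<close> is cancelled next, which requires
    \<open>h \<noteq> 0\<close>.\<close>
  have "(norm h)\<^sup>2 * (norm h)\<^sup>2 \<le> norm (E (X o\<^sub>L X)) * Re (cinner h (L2_inner E J J h)) * (norm h)\<^sup>2"
    using conjugate_variable_inner[OF assms(1-3,5,6)] assms(4)
    by (simp add: cinner_self power2_eq_square flip: of_real_mult)
  then show ?thesis by (rule mult_right_le_imp_le) (use False in simp)
qed simp

end

section \<open>Summation over the variables and the operator inequality\<close>

lemma sum_mult_sum_ge:
  fixes a b :: "'i \<Rightarrow> real"
  assumes "\<And>i. i \<in> I \<Longrightarrow> 0 \<le> a i" "\<And>i. i \<in> I \<Longrightarrow> 0 \<le> b i" "\<And>i. i \<in> I \<Longrightarrow> c\<^sup>2 \<le> a i * b i"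
    and "0 \<le> c"
  shows "(real (card I) * c)\<^sup>2 \<le> sum a I * sum b I"
proof -
  have "(\<Sum>i\<in>I. c) \<le> (\<Sum>i\<in>I. sqrt (a i) * sqrt (b i))"
    using assms by (intro sum_mono) (metis real_le_rsqrt real_sqrt_mult)
  then have "(real (card I) * c)\<^sup>2 \<le> (\<Sum>i\<in>I. sqrt (a i) * sqrt (b i))\<^sup>2"
    using assms(4) by (intro power_mono) auto
  also have "\<dots> \<le> (\<Sum>i\<in>I. (sqrt (a i))\<^sup>2) * (\<Sum>i\<in>I. (sqrt (b i))\<^sup>2)"
    by (rule Cauchy_Schwarz_ineq_sum)
  also have "\<dots> = sum a I * sum b I"
    using assms by simp
  finally show ?thesis .
qed

theorem proposition9p15:
  fixes M B D :: "'h::complex_hilbert_space op set"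
    and E :: "'h op \<Rightarrow> 'h op"
    and X :: "nat \<Rightarrow> 'h op"
    and n :: nat
  assumes "von_neumann_algebra M" and "von_neumann_algebra B" and "von_neumann_algebra D"
    and "D \<subseteq> B" and "B \<subseteq> M"
    and "conditional_expectation M D E" and "faithful_map M E" and "normal_map M D E"
    and "\<forall>j\<in>{1..n}. X j \<in> M \<and> star (X j) = X j"
    and "\<forall>j\<in>{1..n}. algebraically_free (vN_without B n X j) (X j)"
    and "\<forall>j\<in>{1..n}. \<exists>J. is_conjugate_variable M D E (vN_without B n X j) (X j) J"
  shows "free_Fisher M D E B n X \<in> pos_cone D \<and>
    vN_le D ((real n)\<^sup>2 *\<^sub>R id_blinfun)
      ((\<Sum>j\<in>{1..n}. norm (E (X j o\<^sub>L X j))) *\<^sub>R free_Fisher M D E B n X)"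
proof -
  interpret vN_expectation M D E
    using assms by unfold_locales auto
  define C where "C j = vN_without B n X j" for j
  define J where "J j = conjugate_variable M D E (C j) (X j)" for j
  define b where "b j = L2_inner E (J j) (J j)" for j
  define a where "a j = norm (E (X j o\<^sub>L X j))" for j
  define \<Phi> where "\<Phi> = sum b {1..n}"
  have Fisher: "free_Fisher M D E B n X = \<Phi>"
    by (simp add: free_Fisher_def \<Phi>_def b_def J_def C_def Let_def)
  have X: "X j \<in> M" "star (X j) = X j" if "j \<in> {1..n}" for j
    using assms(9) that by auto
  have gen: "B \<union> X ` ({1..n} - {j}) \<subseteq> M" for j
    using assms(5) X by auto
  \<comment> \<open>The coefficient algebras must lie in \<open>M\<close>, where \<open>E\<close> is
    controlled, and be von Neumann algebras, as \<open>free_diff_quot_eval\<close> requires.\<close>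
  have C: "von_neumann_algebra (C j)" "C j \<subseteq> M" for j
    using von_neumann_algebra_generated[OF assms(1) gen] vN_generated_subset[OF assms(1) gen]
    by (auto simp: C_def vN_without_def)
  have J: "is_conjugate_variable M D E (C j) (X j) (J j)" if "j \<in> {1..n}" for j
    unfolding J_def using that assms(11) C X
    by (intro is_conjugate_variable_conjugate_variable) (auto simp: C_def)
  have b: "b j \<in> D" "positive_op (b j)" if "j \<in> {1..n}" for j
    using L2_inner_self_in_pos_cone[of "J j"] J[OF that]
    by (auto simp: b_def pos_cone_def is_conjugate_variable_def L2_closure_def)
  have \<Phi>_D: "\<Phi> \<in> D"
    unfolding \<Phi>_def by (intro unital_star_algebra_sum[OF star_algebra_D] b)
  have cinner_sum: "cinner h (sum b I h) = (\<Sum>j\<in>I. cinner h (b j h))" for h I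
    by (induction I rule: infinite_finite_induct) (auto simp: blinfun.add_left cinner_add_right)
  have pos: "cinner h (\<Phi> h) \<in> \<real>" "0 \<le> Re (cinner h (\<Phi> h))" for h
    using b(2) by (auto simp: \<Phi>_def cinner_sum positive_op_def intro!: sum_in_Reals sum_nonneg)
  have lower: "(real n)\<^sup>2 * (norm h)\<^sup>2 \<le> sum a {1..n} * Re (cinner h (\<Phi> h))" for h
  proof -
    \<comment> \<open>The vector \<open>h\<close> is fixed before summing: the scalar Cauchy-Schwarz
      inequality is used with \<open>c = norm h\<close>, once for each \<open>h\<close>.\<close>
    have "(real (card {1..n}) * norm h)\<^sup>2 \<le> sum a {1..n} * (\<Sum>j\<in>{1..n}. Re (cinner h (b j h)))"
    proof (rule sum_mult_sum_ge)
      fix j assume j: "j \<in> {1..n}"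
      then show "(norm h)\<^sup>2 \<le> a j * Re (cinner h (b j h))"
        using conjugate_variable_lower_bound[OF C X[OF j] _ J[OF j]] assms(10)
        by (simp add: a_def b_def C_def)
      show "0 \<le> Re (cinner h (b j h))" using b[OF j] by (simp add: positive_op_def)
    qed (auto simp: a_def)
    then show ?thesis
      by (simp add: \<Phi>_def cinner_sum power_mult_distrib)
  qed
  let ?d = "sum a {1..n} *\<^sub>R \<Phi> - (real n)\<^sup>2 *\<^sub>R id_blinfun"
  have "?d \<in> D" using \<Phi>_D by simp
  \<comment> \<open>The order of \<open>D\<close> is tested by quadratic forms: \<open>pos\<close>
    makes this expression real and \<open>lower\<close> makes it nonnegative.\<close>
  moreover have "cinner h (?d h) = of_real (sum a {1..n}) * cinner h (\<Phi> h) - of_real ((real n)\<^sup>2 * (norm h)\<^sup>2)" for h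
    by (simp add: blinfun.diff_left blinfun.scaleR_left cinner_diff_right cinner_scaleR_right
        cinner_self)
  then have "positive_op ?d"
    using pos(1) lower \<open>?d \<in> D\<close> by (auto simp: positive_op_def intro!: M_clinear Reals_diff Reals_mult)
  ultimately show ?thesis
    using pos \<Phi>_D unfolding Fisher vN_le_def pos_cone_def
    by (auto simp: positive_op_def a_def[symmetric] intro: M_clinear)
qed

end
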